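(* Let $K_n$ denote the complete graph on $n\ge 1$ vertices. Then for every positive integer $r$, the $\mathbb N$-graded Betti numbers are given, for all $i\ge 1$ and all $d$, by $$\beta_{i,i+d}(R_{K_n}/I_r(K_n))=\begin{cases}\binom{i+d-1}{d}\binom{n}{i+d} & \text{if } d=r \text{ and } 1\le i\le n-r,\\ 0 & \text{otherwise.}\end{cases}$$
   Context: $\mathbb K$ is a field. For a finite simple graph $G$ with vertex set $V(G)$, $R_G$ is the polynomial ring over $\mathbb K$ whose variables are the vertices of $G$ (standard grading). For a positive integer $r$, $I_r(G)\subseteq R_G$ is the square-free monomial ideal generated by the monomials $\prod_{x\in A}x$, where $A$ ranges over all subsets $A\subseteq V(G)$ with $|A|=r+1$ such that the induced subgraph $G[A]$ is connected ($I_r(G)=0$ if there are none). $\beta_{i,j}(R/I)$ denotes the $(i,j)$-th graded Betti number, i.e. the multiplicity of $R(-j)$ in homological degree $i$ of the graded minimal free resolution of $R/I$. *)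

theory Defs
  imports
    "HOL-Library.Poly_Mapping"
    "Jordan_Normal_Form.Matrix"
    "Graph_Theory.Kuratowski"
begin

section \<open>Polynomial rings on a set of variables\<close>

text \<open>Monomials are finitely supported exponent functions \<^typ>\<open>'v \<Rightarrow>\<^sub>0 nat\<close>, and polynomials are
  finitely supported coefficient functions on monomials, with convolution as product.\<close>

type_synonym ('v, 'k) mpoly = "('v \<Rightarrow>\<^sub>0 nat) \<Rightarrow>\<^sub>0 'k"

definition poly_ring :: "'v set \<Rightarrow> ('v, 'k::zero) mpoly set" where
  "poly_ring V = {p. \<forall>m \<in> Poly_Mapping.keys p. Poly_Mapping.keys m \<subseteq> V}"

definition var :: "'v \<Rightarrow> ('v, 'k::zero_neq_one) mpoly" where
  "var x = Poly_Mapping.single (Poly_Mapping.single x 1) 1"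

definition monomial_degree :: "('v \<Rightarrow>\<^sub>0 nat) \<Rightarrow> nat" where
  "monomial_degree m = (\<Sum>x \<in> Poly_Mapping.keys m. Poly_Mapping.lookup m x)"

text \<open>Standard grading. The zero polynomial is homogeneous of every degree, and it is the only
  homogeneous polynomial of a negative degree.\<close>

definition homogeneous :: "int \<Rightarrow> ('v, 'k::zero) mpoly \<Rightarrow> bool" where
  "homogeneous e p \<longleftrightarrow> (\<forall>m \<in> Poly_Mapping.keys p. int (monomial_degree m) = e)"

text \<open>The ideal of \<^term>\<open>poly_ring V\<close> (not of the full type) generated by \<open>S\<close>.\<close>

definition generated_ideal ::
    "'v set \<Rightarrow> ('v, 'k::field) mpoly set \<Rightarrow> ('v, 'k) mpoly set" where
  "generated_ideal V S =
     {(\<Sum>s\<in>T. c s * s) | T c. finite T \<and> T \<subseteq> S \<and> (\<forall>s\<in>T. c s \<in> poly_ring V)}"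

definition irrelevant_ideal :: "'v set \<Rightarrow> ('v, 'k::field) mpoly set" where
  "irrelevant_ideal V = generated_ideal V (var ` V)"

section \<open>Minimal graded free resolutions and graded Betti numbers\<close>

text \<open>A list \<open>[a\<^sub>0, \<dots>, a\<^bsub>m-1\<^esub>]\<close> of integers stands for the graded free module
  \<open>R(-a\<^sub>0) \<oplus> \<dots> \<oplus> R(-a\<^bsub>m-1\<^esub>)\<close> over \<open>R = poly_ring V\<close>, with elements the vectors of length \<open>m\<close>
  over \<open>R\<close>; its \<open>l\<close>-th basis vector has degree \<open>a\<^sub>l\<close>.\<close>

definition free_module :: "'v set \<Rightarrow> int list \<Rightarrow> ('v, 'k::field) mpoly vec set" where
  "free_module V as =
     {x \<in> carrier_vec (length as). \<forall>k < length as. x $ k \<in> poly_ring V}"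

text \<open>\<open>graded_map V as bs M\<close>: multiplication by \<open>M\<close> is a degree-preserving \<open>R\<close>-linear map from the
  graded free module of \<open>as\<close> to that of \<open>bs\<close>.\<close>

definition graded_map ::
    "'v set \<Rightarrow> int list \<Rightarrow> int list \<Rightarrow> ('v, 'k::field) mpoly mat \<Rightarrow> bool" where
  "graded_map V as bs M \<longleftrightarrow>
     M \<in> carrier_mat (length bs) (length as) \<and>
     (\<forall>k < length bs. \<forall>l < length as.
        M $$ (k, l) \<in> poly_ring V \<and> homogeneous (as ! l - bs ! k) (M $$ (k, l)))"

text \<open>\<open>F i\<close> is the free module in homological degree \<open>i\<close>, and \<open>D i\<close> is the differential from
  \<open>F (i + 1)\<close> to \<open>F i\<close>. The augmentation from \<open>F 0\<close> to \<open>R/I\<close> sends the \<open>l\<close>-th basis vector to the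
  residue class of \<open>\<epsilon> $ l\<close>, hence \<open>x\<close> to the class of \<open>\<epsilon> \<bullet> x\<close>; the clauses after the two
  on degrees say that it is surjective, and that the complex is exact at \<open>F 0\<close> and at every
  \<open>F (i + 1)\<close>.\<close>

definition graded_free_resolution ::
    "'v set \<Rightarrow> ('v, 'k::field) mpoly set \<Rightarrow> (nat \<Rightarrow> int list) \<Rightarrow> ('v, 'k) mpoly vec
      \<Rightarrow> (nat \<Rightarrow> ('v, 'k) mpoly mat) \<Rightarrow> bool" where
  "graded_free_resolution V I F \<epsilon> D \<longleftrightarrow>
     \<epsilon> \<in> free_module V (F 0) \<and> (\<forall>l < length (F 0). homogeneous (F 0 ! l) (\<epsilon> $ l)) \<and>
     (\<forall>i. graded_map V (F (Suc i)) (F i) (D i)) \<and>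
     (\<forall>f \<in> poly_ring V. \<exists>x \<in> free_module V (F 0). f - \<epsilon> \<bullet> x \<in> I) \<and>
     {x \<in> free_module V (F 0). \<epsilon> \<bullet> x \<in> I} = (*\<^sub>v) (D 0) ` free_module V (F (Suc 0)) \<and>
     (\<forall>i. {x \<in> free_module V (F (Suc i)). D i *\<^sub>v x = 0\<^sub>v (length (F i))}
            = (*\<^sub>v) (D (Suc i)) ` free_module V (F (Suc (Suc i))))"

text \<open>Minimality says that the image of each differential lies in \<open>\<mm> F i\<close>, where \<open>\<mm>\<close> is the
  irrelevant ideal.\<close>

definition minimal_graded_free_resolution ::
    "'v set \<Rightarrow> ('v, 'k::field) mpoly set \<Rightarrow> (nat \<Rightarrow> int list) \<Rightarrow> ('v, 'k) mpoly vec
      \<Rightarrow> (nat \<Rightarrow> ('v, 'k) mpoly mat) \<Rightarrow> bool" where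
  "minimal_graded_free_resolution V I F \<epsilon> D \<longleftrightarrow>
     graded_free_resolution V I F \<epsilon> D \<and>
     (\<forall>i. \<forall>k < length (F i). \<forall>l < length (F (Suc i)). D i $$ (k, l) \<in> irrelevant_ideal V)"

text \<open>\<open>graded_betti V I i j\<close> is the multiplicity of \<open>R(-j)\<close> in homological degree \<open>i\<close> of the
  minimal graded free resolution of \<open>R/I\<close>. It is intended for a finite set \<open>V\<close> and a homogeneous
  ideal \<open>I\<close>, where that resolution exists and is unique up to isomorphism, so that the description
  determines the number.\<close>

definition graded_betti :: "'v set \<Rightarrow> ('v, 'k::field) mpoly set \<Rightarrow> nat \<Rightarrow> int \<Rightarrow> nat" where
  "graded_betti V I i j =
     (THE b. \<exists>F \<epsilon> D. minimal_graded_free_resolution V I F \<epsilon> D \<and> b = count_list (F i) j)"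

section \<open>The ideal of connected induced subgraphs\<close>

text \<open>A finite simple graph is a \<^const>\<open>graph\<close>, that is, a finite symmetric digraph without loops
  and parallel arcs; \<open>G \<restriction> A\<close> is the induced subgraph.\<close>

definition connected_ideal :: "nat \<Rightarrow> ('v, 'e) pre_digraph \<Rightarrow> ('v, 'k::field) mpoly set" where
  "connected_ideal r G =
     generated_ideal (verts G)
       {(\<Prod>x\<in>A. var x) | A. A \<subseteq> verts G \<and> card A = r + 1 \<and> Digraph_Component.connected (G \<restriction> A)}"

end

theory Submission
  imports Defs "Jordan_Normal_Form.Determinant"
begin

text \<open>Identify the vertices with numbers. Then \<open>I\<^sub>r(K\<^sub>n)\<close> is generated by all squarefree monomials of
  degree \<open>r + 1\<close>, and ordering these by the sum of their vertices gives linear quotients: the colon ideal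
  at \<open>u\<close> is generated by the variables outside \<open>u\<close> below the maximum of \<open>u\<close>. Iterated mapping cones
  with Koszul complexes yield a resolution that is linear, hence minimal, and whose ranks are sums of binomial
  coefficients. The ranks of any other minimal resolution are the same: comparison maps in
  both directions compose to the identity up to homotopy, and homotopies vanish modulo the variables.\<close>

section \<open>Homogeneous parts of polynomials\<close>

text \<open>\<open>graded_betti\<close> is a definite description, so one resolution alone settles
  nothing: an arbitrary minimal resolution, with its own \<open>F 0\<close> and augmentation, has to
  be compared with the one constructed. The comparison counts basis vectors of one fixed degree, so
  all maps must preserve degrees; for this reason lifts are cut down to homogeneous parts. Linearity
  excludes cancellation in the cones: a Koszul complex twisted by the degree \<open>r + 1\<close> of
  the new generator contributes in homological degree \<open>i + 1\<close> only basis vectors of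
  degree \<open>r + 1 + i\<close>, so all entries of the differentials have positive degree. The
  generator \<open>u\<close> contributes \<open>m choose i\<close>, where \<open>m\<close> counts
  the vertices outside \<open>u\<close> below its maximum. The colon ideals have the stated form
  because exchanging an element of \<open>u\<close> for a smaller vertex lowers the sum, while any
  other set of the same size and no larger sum contains a vertex outside \<open>u\<close> below the
  maximum. Ties in the sum are therefore harmless.\<close>

lemma poly_ringI: "(\<And>m. m \<in> Poly_Mapping.keys p \<Longrightarrow> Poly_Mapping.keys m \<subseteq> V) \<Longrightarrow> p \<in> poly_ring V"
  by (auto simp: poly_ring_def)

lemma poly_ring_zero [simp]: "0 \<in> poly_ring V"
  and poly_ring_one [simp]: "(1 :: ('v, 'k::zero_neq_one) mpoly) \<in> poly_ring V"
  by (auto simp: poly_ring_def)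

lemma poly_ring_add [intro]:
  fixes p q :: "('v, 'k::monoid_add) mpoly"
  shows "p \<in> poly_ring V \<Longrightarrow> q \<in> poly_ring V \<Longrightarrow> p + q \<in> poly_ring V"
  using keys_add[of p q] by (fastforce simp: poly_ring_def)

lemma poly_ring_mult [intro]:
  fixes p q :: "('v, 'k::semiring_0) mpoly"
  assumes "p \<in> poly_ring V" "q \<in> poly_ring V"
  shows "p * q \<in> poly_ring V"
proof (rule poly_ringI)
  fix m assume "m \<in> Poly_Mapping.keys (p * q)"
  then obtain a b where "m = a + b" "a \<in> Poly_Mapping.keys p" "b \<in> Poly_Mapping.keys q"
    using keys_mult[of p q] by auto
  then show "Poly_Mapping.keys m \<subseteq> V"
    using assms keys_add[of a b] by (fastforce simp: poly_ring_def)
qed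

lemma poly_ring_uminus [simp]:
  fixes p :: "('v, 'k::ab_group_add) mpoly"
  shows "- p \<in> poly_ring V \<longleftrightarrow> p \<in> poly_ring V"
  by (simp add: poly_ring_def in_keys_iff)

lemma poly_ring_diff [intro]:
  fixes p q :: "('v, 'k::ab_group_add) mpoly"
  shows "p \<in> poly_ring V \<Longrightarrow> q \<in> poly_ring V \<Longrightarrow> p - q \<in> poly_ring V"
  using poly_ring_add[of p V "- q"] by simp

lemma poly_ring_sum [intro]:
  fixes f :: "'a \<Rightarrow> ('v, 'k::comm_monoid_add) mpoly"
  shows "(\<And>a. a \<in> A \<Longrightarrow> f a \<in> poly_ring V) \<Longrightarrow> sum f A \<in> poly_ring V"
  by (induction A rule: infinite_finite_induct) auto

lemma monomial_degree_superset:
  assumes "finite A" "Poly_Mapping.keys m \<subseteq> A"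
  shows "monomial_degree m = (\<Sum>x\<in>A. Poly_Mapping.lookup m x)"
  unfolding monomial_degree_def by (rule sum.mono_neutral_left) (use assms in \<open>auto simp: in_keys_iff\<close>)

lemma monomial_degree_add [simp]: "monomial_degree (a + b) = monomial_degree a + monomial_degree b"
proof -
  define A where "A = Poly_Mapping.keys a \<union> Poly_Mapping.keys b"
  have A: "finite A" "Poly_Mapping.keys a \<subseteq> A" "Poly_Mapping.keys b \<subseteq> A" by (auto simp: A_def)
  show ?thesis
    using A monomial_degree_superset[OF A(1), of a] monomial_degree_superset[OF A(1), of b]
      monomial_degree_superset[OF A(1), of "a + b"] keys_add[of a b]
    by (simp add: A_def sum.distrib lookup_add)
qed

lemma monomial_degree_zero [simp]: "monomial_degree 0 = 0"
  by (simp add: monomial_degree_def)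

lemma homogeneous_zero [simp]: "homogeneous e 0"
  by (simp add: homogeneous_def)

lemma homogeneous_one [simp]: "homogeneous 0 (1 :: ('v, 'k::zero_neq_one) mpoly)"
  by (simp add: homogeneous_def)

lemma homogeneous_add:
  fixes p q :: "('v, 'k::monoid_add) mpoly"
  shows "homogeneous e p \<Longrightarrow> homogeneous e q \<Longrightarrow> homogeneous e (p + q)"
  using keys_add[of p q] by (fastforce simp: homogeneous_def)

lemma homogeneous_uminus [simp]:
  fixes p :: "('v, 'k::ab_group_add) mpoly"
  shows "homogeneous e (- p) \<longleftrightarrow> homogeneous e p"
  by (simp add: homogeneous_def in_keys_iff)

lemma homogeneous_diff:
  fixes p q :: "('v, 'k::ab_group_add) mpoly"
  shows "homogeneous e p \<Longrightarrow> homogeneous e q \<Longrightarrow> homogeneous e (p - q)"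
  using homogeneous_add[of e p "- q"] by simp

lemma homogeneous_mult:
  fixes p q :: "('v, 'k::semiring_0) mpoly"
  assumes "homogeneous a p" "homogeneous b q"
  shows "homogeneous (a + b) (p * q)"
  unfolding homogeneous_def
proof
  fix m assume "m \<in> Poly_Mapping.keys (p * q)"
  then obtain x y where "m = x + y" "x \<in> Poly_Mapping.keys p" "y \<in> Poly_Mapping.keys q"
    using keys_mult[of p q] by auto
  then show "int (monomial_degree m) = a + b"
    using assms by (simp add: homogeneous_def)
qed

lemma homogeneous_sum:
  fixes f :: "'a \<Rightarrow> ('v, 'k::comm_monoid_add) mpoly"
  shows "(\<And>a. a \<in> A \<Longrightarrow> homogeneous e (f a)) \<Longrightarrow> homogeneous e (sum f A)"
  by (induction A rule: infinite_finite_induct) (auto intro: homogeneous_add)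

text \<open>Restriction by an arbitrary predicate serves two purposes: homogeneous parts, and the
  part of a polynomial divisible by a fixed monomial in
  \<open>monomial_ideal_insert\<close>.\<close>

definition keys_restrict :: "('a \<Rightarrow> bool) \<Rightarrow> ('a \<Rightarrow>\<^sub>0 'k::comm_monoid_add) \<Rightarrow> 'a \<Rightarrow>\<^sub>0 'k" where
  "keys_restrict P p = (\<Sum>m\<in>{m \<in> Poly_Mapping.keys p. P m}. Poly_Mapping.single m (Poly_Mapping.lookup p m))"

lemma lookup_keys_restrict:
  "Poly_Mapping.lookup (keys_restrict P p) m = (if P m then Poly_Mapping.lookup p m else 0)"
proof -
  have "Poly_Mapping.lookup (keys_restrict P p) m
      = (\<Sum>k\<in>{k \<in> Poly_Mapping.keys p. P k}. if k = m then Poly_Mapping.lookup p m else 0)"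
    unfolding keys_restrict_def lookup_sum by (rule sum.cong) (auto simp: lookup_single when_def)
  then show ?thesis by (auto simp: in_keys_iff)
qed

lemma keys_keys_restrict [simp]:
  "Poly_Mapping.keys (keys_restrict P p) = {m \<in> Poly_Mapping.keys p. P m}"
  by (auto simp: in_keys_iff lookup_keys_restrict split: if_splits)

lemma keys_restrict_split: "p = keys_restrict P p + keys_restrict (\<lambda>m. \<not> P m) p"
  by (rule poly_mapping_eqI) (simp add: lookup_add lookup_keys_restrict)

lemma keys_restrict_diff:
  fixes p q :: "'a \<Rightarrow>\<^sub>0 'k::ab_group_add"
  shows "keys_restrict P (p - q) = keys_restrict P p - keys_restrict P q"
  by (rule poly_mapping_eqI) (simp add: lookup_minus lookup_keys_restrict)

lemma keys_restrict_sum: "keys_restrict P (sum f A) = (\<Sum>a\<in>A. keys_restrict P (f a))"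
  by (rule poly_mapping_eqI) (simp add: lookup_sum lookup_keys_restrict)

lemma keys_restrict_poly_ring [intro]: "p \<in> poly_ring V \<Longrightarrow> keys_restrict P p \<in> poly_ring V"
  by (auto simp: poly_ring_def)

abbreviation homogeneous_part :: "int \<Rightarrow> ('v, 'k::comm_monoid_add) mpoly \<Rightarrow> ('v, 'k) mpoly" where
  "homogeneous_part e \<equiv> keys_restrict (\<lambda>m. int (monomial_degree m) = e)"

lemma homogeneous_homogeneous_part [simp]: "homogeneous e (homogeneous_part e p)"
  by (simp add: homogeneous_def)

lemma homogeneous_part_eq: "homogeneous e p \<Longrightarrow> homogeneous_part e p = p"
  by (rule poly_mapping_eqI) (auto simp: homogeneous_def lookup_keys_restrict in_keys_iff)

text \<open>Terms of \<open>q\<close> outside degree \<open>b\<close> only produce terms outside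
  degree \<open>a + b\<close>. This allows a solution of a linear equation with homogeneous data to
  be replaced by a homogeneous one.\<close>

lemma homogeneous_part_mult:
  fixes p q :: "('v, 'k::semiring_0) mpoly"
  assumes "homogeneous a p"
  shows "homogeneous_part (a + b) (p * q) = p * homogeneous_part b q"
proof (rule poly_mapping_eqI)
  fix m
  let ?q' = "keys_restrict (\<lambda>m. int (monomial_degree m) \<noteq> b) q"
  have split: "p * q = p * homogeneous_part b q + p * ?q'"
    by (metis distrib_left keys_restrict_split)
  have hom: "homogeneous (a + b) (p * homogeneous_part b q)"
    by (rule homogeneous_mult[OF assms]) simp
  have zero: "Poly_Mapping.lookup (p * ?q') m = 0" if "int (monomial_degree m) = a + b"
  proof (rule ccontr)
    assume "Poly_Mapping.lookup (p * ?q') m \<noteq> 0"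
    then obtain x y where "m = x + y" "x \<in> Poly_Mapping.keys p" "y \<in> Poly_Mapping.keys ?q'"
      using keys_mult[of p ?q'] by (auto simp: in_keys_iff)
    then show False using that assms by (auto simp: homogeneous_def)
  qed
  show "Poly_Mapping.lookup (homogeneous_part (a + b) (p * q)) m = Poly_Mapping.lookup (p * homogeneous_part b q) m"
  proof (cases "int (monomial_degree m) = a + b")
    case True
    then show ?thesis using zero by (simp add: lookup_keys_restrict split lookup_add)
  next
    case False
    then show ?thesis using hom by (auto simp: lookup_keys_restrict homogeneous_def in_keys_iff)
  qed
qed

text \<open>Exponents are natural numbers, so the monomial \<open>1\<close> factors only trivially.
  Taking constant coefficients is thus multiplicative and realizes reduction modulo the
  variables.\<close>

lemma lookup_mult_zero:
  fixes p q :: "('v, 'k::semiring_0) mpoly"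
  shows "Poly_Mapping.lookup (p * q) 0 = Poly_Mapping.lookup p 0 * Poly_Mapping.lookup q 0"
proof -
  have zero_add: "(0 = l + m) = (l = 0 \<and> m = 0)" for l m :: "'v \<Rightarrow>\<^sub>0 nat"
    by (auto simp: poly_mapping_eq_iff fun_eq_iff lookup_add)
  have "Poly_Mapping.lookup (p * q) 0
      = (\<Sum>l. Poly_Mapping.lookup p l * Poly_Mapping.lookup q 0 when l = 0)"
    unfolding lookup_mult zero_add by (intro Sum_any.cong) (auto simp: when_def)
  then show ?thesis by simp
qed

section \<open>Monomial ideals\<close>

text \<open>Monomials are compared exponentwise, that is, by divisibility.\<close>

definition monomial_ideal :: "'v set \<Rightarrow> ('v \<Rightarrow>\<^sub>0 nat) set \<Rightarrow> ('v, 'k::field) mpoly set" where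
  "monomial_ideal V M = {f \<in> poly_ring V. \<forall>k \<in> Poly_Mapping.keys f. \<exists>m\<in>M.
     \<forall>x. Poly_Mapping.lookup m x \<le> Poly_Mapping.lookup k x}"

text \<open>For the harder inclusion, a polynomial is expanded into its terms, and each term is
  written as a cofactor times a chosen divisor in \<open>M\<close>.\<close>

lemma generated_ideal_monomial:
  assumes M: "\<And>m. m \<in> M \<Longrightarrow> Poly_Mapping.keys m \<subseteq> V"
  shows "generated_ideal V ((\<lambda>m. Poly_Mapping.single m 1) ` M) = (monomial_ideal V M :: ('v, 'k::field) mpoly set)"
    (is "generated_ideal V (?X ` M) = _")
proof (intro equalityI subsetI)
  fix f assume "f \<in> generated_ideal V (?X ` M)"
  then obtain T c where f: "f = (\<Sum>s\<in>T. c s * s)" "finite T" "T \<subseteq> ?X ` M" "\<forall>s\<in>T. c s \<in> poly_ring V"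
    by (auto simp: generated_ideal_def)
  have 1: "c s * s \<in> poly_ring V" if s: "s \<in> T" for s
  proof -
    obtain m where "s = ?X m" "m \<in> M" using f(3) s by auto
    then show ?thesis using f(4) s M by (intro poly_ring_mult) (auto simp: poly_ring_def)
  qed
  have 2: "\<exists>m\<in>M. \<forall>x. Poly_Mapping.lookup m x \<le> Poly_Mapping.lookup k x"
    if k: "k \<in> Poly_Mapping.keys f" for k
  proof -
    have "(\<Sum>s\<in>T. Poly_Mapping.lookup (c s * s) k) \<noteq> 0"
      using k by (simp add: f(1) in_keys_iff lookup_sum)
    then obtain s where s: "s \<in> T" "k \<in> Poly_Mapping.keys (c s * s)"
      by (meson in_keys_iff sum.neutral)
    then obtain m where m: "m \<in> M" "s = ?X m" using f(3) by auto
    obtain a where "k = a + m" using s(2) keys_mult[of "c s" s] m by auto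
    then show ?thesis using m by (intro bexI[of _ m]) (simp_all add: lookup_add)
  qed
  show "f \<in> monomial_ideal V M"
    using 2 poly_ring_sum[of T "\<lambda>s. c s * s" V] 1 by (auto simp: monomial_ideal_def f(1))
next
  fix f :: "('v, 'k) mpoly" assume f: "f \<in> monomial_ideal V M"
  then have "\<forall>k\<in>Poly_Mapping.keys f. \<exists>m. m \<in> M \<and> (\<forall>x. Poly_Mapping.lookup m x \<le> Poly_Mapping.lookup k x)"
    by (auto simp: monomial_ideal_def)
  from bchoice[OF this] obtain g where g: "\<And>k. k \<in> Poly_Mapping.keys f \<Longrightarrow> g k \<in> M"
    "\<And>k x. k \<in> Poly_Mapping.keys f \<Longrightarrow> Poly_Mapping.lookup (g k) x \<le> Poly_Mapping.lookup k x"
    by metis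
  let ?K = "Poly_Mapping.keys f"
  let ?h = "\<lambda>k. Poly_Mapping.single k (Poly_Mapping.lookup f k)"
  \<comment> \<open>\<open>generated_ideal\<close> admits one coefficient per generator, so the
    cofactors of all terms with the same chosen divisor are collected.\<close>
  define c where "c s = (\<Sum>k\<in>{k \<in> ?K. ?X (g k) = s}. Poly_Mapping.single (k - g k) (Poly_Mapping.lookup f k))" for s :: "('v, 'k) mpoly"
  have split: "k - g k + g k = k" if "k \<in> ?K" for k
    by (rule poly_mapping_eqI) (simp add: lookup_add lookup_minus g(2)[OF that])
  have "f = sum ?h ?K"
    using keys_restrict_split[of f "\<lambda>_. True"] by (simp add: keys_restrict_def)
  also have "\<dots> = (\<Sum>s\<in>(\<lambda>k. ?X (g k)) ` ?K. sum ?h {k \<in> ?K. ?X (g k) = s})"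
    by (rule sum.image_gen) simp
  also have "\<dots> = (\<Sum>s\<in>(\<lambda>k. ?X (g k)) ` ?K. c s * s)"
  proof (rule sum.cong[OF refl])
    fix s
    have "?h k = Poly_Mapping.single (k - g k) (Poly_Mapping.lookup f k) * s" if "k \<in> {k \<in> ?K. ?X (g k) = s}" for k
      using that split[of k] by (auto simp: mult_single)
    then show "sum ?h {k \<in> ?K. ?X (g k) = s} = c s * s"
      unfolding c_def sum_distrib_right by (rule sum.cong[OF refl])
  qed
  finally have "f = (\<Sum>s\<in>(\<lambda>k. ?X (g k)) ` ?K. c s * s)" .
  moreover have "c s \<in> poly_ring V" for s
    unfolding c_def
  proof (intro poly_ring_sum poly_ringI)
    fix k m assume k: "k \<in> {k \<in> ?K. ?X (g k) = s}" "m \<in> Poly_Mapping.keys (Poly_Mapping.single (k - g k) (Poly_Mapping.lookup f k))"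
    then have "Poly_Mapping.keys k \<subseteq> V" using f by (auto simp: monomial_ideal_def poly_ring_def)
    moreover have "Poly_Mapping.keys (k - g k) \<subseteq> Poly_Mapping.keys k"
      by (auto simp: in_keys_iff lookup_minus)
    ultimately show "Poly_Mapping.keys m \<subseteq> V" using k by (auto split: if_splits)
  qed
  moreover have "(\<lambda>k. ?X (g k)) ` ?K \<subseteq> ?X ` M" using g(1) by auto
  ultimately show "f \<in> generated_ideal V (?X ` M)"
    unfolding generated_ideal_def by (intro CollectI exI conjI) (assumption | simp)+
qed

text \<open>Splitting off the terms divisible by \<open>m\<close> brings the enlarged ideal into the
  form that the mapping cone produces in degree 0.\<close>

lemma monomial_ideal_insert:
  assumes m: "Poly_Mapping.keys m \<subseteq> V"
  shows "monomial_ideal V (insert m M) =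
    {f + Poly_Mapping.single m 1 * g | f g. f \<in> monomial_ideal V M \<and> g \<in> (poly_ring V :: ('v, 'k::field) mpoly set)}"
    (is "?L = ?R")
proof (intro equalityI subsetI)
  fix p :: "('v, 'k) mpoly" assume p: "p \<in> ?L"
  let ?P = "\<lambda>k. \<forall>x. Poly_Mapping.lookup m x \<le> Poly_Mapping.lookup k x"
  have "keys_restrict ?P p \<in> monomial_ideal V {m}"
    using p by (auto simp: monomial_ideal_def)
  also have "\<dots> = generated_ideal V ((\<lambda>m. Poly_Mapping.single m 1) ` {m})"
    using m by (intro generated_ideal_monomial[symmetric]) auto
  finally obtain T c where T: "keys_restrict ?P p = (\<Sum>s\<in>T. c s * s)" "T \<subseteq> {Poly_Mapping.single m 1}"
    "\<forall>s\<in>T. c s \<in> poly_ring V" by (auto simp: generated_ideal_def)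
  have "\<exists>g\<in>poly_ring V. keys_restrict ?P p = Poly_Mapping.single m 1 * g"
  proof (cases "T = {}")
    case True
    then show ?thesis using T by (intro bexI[of _ 0]) auto
  next
    case False
    then have "T = {Poly_Mapping.single m 1}" using T(2) by auto
    then show ?thesis
      using T(1,3) by (intro bexI[of _ "c (Poly_Mapping.single m 1)"]) (simp_all add: mult.commute)
  qed
  then obtain g where g: "g \<in> poly_ring V" "keys_restrict ?P p = Poly_Mapping.single m 1 * g" by auto
  moreover have "keys_restrict (\<lambda>k. \<not> ?P k) p \<in> monomial_ideal V M"
    using p by (auto simp: monomial_ideal_def)
  moreover have "p = keys_restrict (\<lambda>k. \<not> ?P k) p + keys_restrict ?P p"
    using keys_restrict_split[of p ?P] by (simp add: add.commute)
  ultimately show "p \<in> ?R" by (metis (mono_tags, lifting) mem_Collect_eq)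
next
  fix p :: "('v, 'k) mpoly" assume "p \<in> ?R"
  then obtain f g where p: "p = f + Poly_Mapping.single m 1 * g" and f: "f \<in> monomial_ideal V M" and g: "g \<in> poly_ring V"
    by auto
  have "Poly_Mapping.single m 1 * g \<in> poly_ring V"
    using m g by (intro poly_ring_mult) (auto simp: poly_ring_def)
  moreover have "Poly_Mapping.keys p \<subseteq> Poly_Mapping.keys f \<union> (+) m ` Poly_Mapping.keys g"
    using keys_add[of f "Poly_Mapping.single m 1 * g"] keys_mult[of "Poly_Mapping.single m 1" g]
    unfolding p by fastforce
  ultimately show "p \<in> ?L"
    using f unfolding monomial_ideal_def p by (fastforce simp: lookup_add)
qed

lemma monomial_ideal_subset: "monomial_ideal V M \<subseteq> poly_ring V"
  by (auto simp: monomial_ideal_def)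

lemma monomial_ideal_add:
  "f \<in> monomial_ideal V M \<Longrightarrow> g \<in> monomial_ideal V M \<Longrightarrow> f + g \<in> monomial_ideal V M"
  using keys_add[of f g] by (fastforce simp: monomial_ideal_def)

lemma monomial_ideal_mult:
  fixes f g :: "('v, 'k::field) mpoly"
  assumes "f \<in> poly_ring V" "g \<in> monomial_ideal V M"
  shows "f * g \<in> monomial_ideal V M"
proof -
  have "\<exists>m\<in>M. \<forall>x. Poly_Mapping.lookup m x \<le> Poly_Mapping.lookup k x"
    if k: "k \<in> Poly_Mapping.keys (f * g)" for k
  proof -
    obtain a b where "k = a + b" "b \<in> Poly_Mapping.keys g" using k keys_mult[of f g] by auto
    with assms(2) show ?thesis
      by (fastforce simp: monomial_ideal_def lookup_add intro: trans_le_add2)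
  qed
  then show ?thesis using assms by (auto simp: monomial_ideal_def)
qed

text \<open>Translation of exponents by \<open>m\<close> is injective, so nothing cancels. The exact
  support, not just an inclusion, is needed to decide membership in colon ideals.\<close>

lemma keys_single_mult:
  fixes g :: "('v, 'k::field) mpoly"
  shows "Poly_Mapping.keys (Poly_Mapping.single m 1 * g) = (+) m ` Poly_Mapping.keys g"
proof (intro equalityI subsetI)
  fix k assume "k \<in> Poly_Mapping.keys (Poly_Mapping.single m 1 * g)"
  then show "k \<in> (+) m ` Poly_Mapping.keys g"
    using keys_mult[of "Poly_Mapping.single m 1" g] by fastforce
next
  fix k assume "k \<in> (+) m ` Poly_Mapping.keys g"
  then obtain l where l: "k = m + l" "l \<in> Poly_Mapping.keys g" by auto
  have "Poly_Mapping.lookup (Poly_Mapping.single m 1 * g) k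
      = (\<Sum>a. (\<Sum>q. Poly_Mapping.lookup g q when m + l = a + q) when a = m)"
    unfolding lookup_mult l(1) by (intro Sum_any.cong) (auto simp: lookup_single when_def)
  also have "\<dots> = Poly_Mapping.lookup g l" by (simp)
  finally show "k \<in> Poly_Mapping.keys (Poly_Mapping.single m 1 * g)" using l(2) by (simp add: in_keys_iff)
qed

section \<open>The irrelevant ideal and constant coefficients\<close>

lemma irrelevant_ideal_monomial:
  "irrelevant_ideal V = (monomial_ideal V ((\<lambda>x. Poly_Mapping.single x 1) ` V) :: ('v, 'k::field) mpoly set)"
  unfolding irrelevant_ideal_def
  by (subst generated_ideal_monomial[symmetric]) (auto simp: var_def image_image)

lemma irrelevant_ideal_lookup_zero:
  fixes p :: "('v, 'k::field) mpoly"
  assumes "p \<in> irrelevant_ideal V"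
  shows "Poly_Mapping.lookup p 0 = 0"
proof (rule ccontr)
  assume "Poly_Mapping.lookup p 0 \<noteq> 0"
  then have "0 \<in> Poly_Mapping.keys p" by (simp add: in_keys_iff)
  then obtain x :: 'v where "\<forall>y. Poly_Mapping.lookup (Poly_Mapping.single x (1::nat)) y \<le> Poly_Mapping.lookup 0 y"
    using assms unfolding irrelevant_ideal_monomial monomial_ideal_def by blast
  then show False by (metis le_zero_eq lookup_single_eq lookup_zero zero_neq_one)
qed

text \<open>A monomial of positive degree contains a variable. Hence minimality can be read off from
  the degrees of the basis vectors.\<close>

lemma homogeneous_irrelevant_ideal:
  fixes p :: "('v, 'k::field) mpoly"
  assumes "p \<in> poly_ring V" "homogeneous e p" "e > 0"
  shows "p \<in> irrelevant_ideal V"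
proof -
  have "\<exists>m\<in>(\<lambda>x. Poly_Mapping.single x 1) ` V. \<forall>x. Poly_Mapping.lookup m x \<le> Poly_Mapping.lookup k x"
    if k: "k \<in> Poly_Mapping.keys p" for k
  proof -
    have "monomial_degree k > 0" using assms k by (auto simp: homogeneous_def)
    then have "k \<noteq> 0" by auto
    then obtain x where x: "x \<in> Poly_Mapping.keys k" by (metis keys_eq_empty all_not_in_conv)
    moreover have "x \<in> V" using assms(1) k x by (auto simp: poly_ring_def)
    ultimately show ?thesis
      by (intro bexI[of _ "Poly_Mapping.single x 1"]) (auto simp: lookup_single when_def in_keys_iff)
  qed
  then show ?thesis using assms(1) by (auto simp: irrelevant_ideal_monomial monomial_ideal_def)
qed

section \<open>Free modules and acyclic complexes\<close>

lemma free_moduleI: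
  "x \<in> carrier_vec (length as) \<Longrightarrow> (\<And>k. k < length as \<Longrightarrow> x $ k \<in> poly_ring V) \<Longrightarrow> x \<in> free_module V as"
  by (simp add: free_module_def)

lemma free_module_carrier: "x \<in> free_module V as \<Longrightarrow> x \<in> carrier_vec (length as)"
  by (simp add: free_module_def)

lemma free_module_add:
  "x \<in> free_module V as \<Longrightarrow> y \<in> free_module V as \<Longrightarrow> x + y \<in> free_module V as"
  by (auto simp: free_module_def intro!: poly_ring_add)

lemma free_module_diff:
  "x \<in> free_module V as \<Longrightarrow> y \<in> free_module V as \<Longrightarrow> x - y \<in> free_module V as"
  by (auto simp: free_module_def intro!: poly_ring_diff)

lemma free_module_uminus:
  "x \<in> free_module V as \<Longrightarrow> - x \<in> free_module V as"
  by (auto simp: free_module_def)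

lemma unit_vec_free_module: "unit_vec (length as) l \<in> free_module V as"
  by (auto simp: free_module_def unit_vec_def)

lemma scalar_prod_poly_ring:
  fixes v w :: "('v, 'k::field) mpoly vec"
  assumes "\<And>k. k < dim_vec w \<Longrightarrow> v $ k \<in> poly_ring V" "\<And>k. k < dim_vec w \<Longrightarrow> w $ k \<in> poly_ring V"
  shows "v \<bullet> w \<in> poly_ring V"
  unfolding scalar_prod_def using assms by (intro poly_ring_sum poly_ring_mult) auto

lemma graded_map_carrier: "graded_map V as bs M \<Longrightarrow> M \<in> carrier_mat (length bs) (length as)"
  by (simp add: graded_map_def)

lemma graded_map_mult_vec:
  assumes "graded_map V as bs M" "x \<in> free_module V as"
  shows "M *\<^sub>v x \<in> free_module V bs"
proof (rule free_moduleI)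
  show "M *\<^sub>v x \<in> carrier_vec (length bs)"
    using assms by (auto simp: graded_map_def free_module_def)
  fix k assume "k < length bs"
  then show "(M *\<^sub>v x) $ k \<in> poly_ring V"
    using assms by (auto simp: graded_map_def free_module_def intro!: scalar_prod_poly_ring)
qed

lemma graded_map_one: "graded_map V as as (1\<^sub>m (length as))"
  by (auto simp: graded_map_def)

lemma graded_map_diff:
  "graded_map V as bs M \<Longrightarrow> graded_map V as bs N \<Longrightarrow> graded_map V as bs (M - N)"
  by (auto simp: graded_map_def intro!: homogeneous_diff poly_ring_diff)

lemma graded_map_uminus:
  "graded_map V as bs M \<Longrightarrow> graded_map V as bs (- M)"
  by (auto simp: graded_map_def)

lemma graded_map_mult:
  assumes M: "graded_map V bs cs M" and N: "graded_map V as bs N"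
  shows "graded_map V as cs (M * N)"
  unfolding graded_map_def
proof (intro conjI allI impI)
  show "M * N \<in> carrier_mat (length cs) (length as)"
    using M N by (auto simp: graded_map_def)
  fix k l assume kl: "k < length cs" "l < length as"
  have eq: "(M * N) $$ (k, l) = (\<Sum>i\<in>{0..<length bs}. M $$ (k, i) * N $$ (i, l))"
    using M N kl by (auto simp: graded_map_def scalar_prod_def)
  show "(M * N) $$ (k, l) \<in> poly_ring V"
    unfolding eq using M N kl by (intro poly_ring_sum poly_ring_mult) (auto simp: graded_map_def)
  show "homogeneous (as ! l - cs ! k) ((M * N) $$ (k, l))"
    unfolding eq
  proof (rule homogeneous_sum)
    fix i assume i: "i \<in> {0..<length bs}"
    have "homogeneous ((bs ! i - cs ! k) + (as ! l - bs ! i)) (M $$ (k, i) * N $$ (i, l))"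
      using M N kl i by (intro homogeneous_mult) (auto simp: graded_map_def)
    then show "homogeneous (as ! l - cs ! k) (M $$ (k, i) * N $$ (i, l))" by simp
  qed
qed

lemma mat_mult_unit_vec:
  fixes A :: "'a::semiring_1 mat"
  assumes "A \<in> carrier_mat n m" "l < m"
  shows "A *\<^sub>v unit_vec m l = col A l"
  using assms by (intro eq_vecI) auto

text \<open>The boundaries in homological degree \<open>i\<close>. In degree 0 they are the only
  record of the module that is resolved, namely the quotient of \<open>F 0\<close> by them.\<close>

definition bounds :: "'v set \<Rightarrow> (nat \<Rightarrow> int list) \<Rightarrow> (nat \<Rightarrow> ('v, 'k::field) mpoly mat) \<Rightarrow> nat
    \<Rightarrow> ('v, 'k) mpoly vec set" where
  "bounds V F D i = (*\<^sub>v) (D i) ` free_module V (F (Suc i))"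

text \<open>No condition is imposed in homological degree 0.\<close>

definition acyclic_complex ::
    "'v set \<Rightarrow> (nat \<Rightarrow> int list) \<Rightarrow> (nat \<Rightarrow> ('v, 'k::field) mpoly mat) \<Rightarrow> bool" where
  "acyclic_complex V F D \<longleftrightarrow>
     (\<forall>i. graded_map V (F (Suc i)) (F i) (D i)) \<and>
     (\<forall>i. {x \<in> free_module V (F (Suc i)). D i *\<^sub>v x = 0\<^sub>v (length (F i))} = bounds V F D (Suc i))"

text \<open>Graded projectivity of free modules: the columns of \<open>M\<close> are lifted one at a
  time without control on degrees, and the entries of the lifts are then cut to the required
  degrees. Discarding the rest does not disturb the equation, because the entries of
  \<open>D\<close> and \<open>M\<close> are homogeneous of matching degrees.\<close>

lemma graded_lift:
  assumes D: "graded_map V bs cs D" and M: "graded_map V as cs M"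
    and im: "\<And>x. x \<in> free_module V as \<Longrightarrow> M *\<^sub>v x \<in> (*\<^sub>v) D ` free_module V bs"
  shows "\<exists>N. graded_map V as bs N \<and> D * N = M"
proof -
  have "\<exists>y. y \<in> free_module V bs \<and> col M l = D *\<^sub>v y" if "l < length as" for l
    using im[OF unit_vec_free_module[of as l]] mat_mult_unit_vec[OF graded_map_carrier[OF M] that] by auto
  then obtain y where y: "\<And>l. l < length as \<Longrightarrow> y l \<in> free_module V bs"
    "\<And>l. l < length as \<Longrightarrow> col M l = D *\<^sub>v y l"
    by metis
  let ?N = "mat (length bs) (length as) (\<lambda>(k, l). homogeneous_part (as ! l - bs ! k) (y l $ k))"
  have N: "graded_map V as bs ?N"
    using y(1) by (auto simp: graded_map_def free_module_def)
  moreover have "D * ?N = M"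
  proof (rule eq_matI)
    fix c l assume "c < dim_row M" "l < dim_col M"
    with M have cl: "c < length cs" "l < length as" by (auto simp: graded_map_def)
    let ?d = "as ! l - cs ! c"
    have "(D * ?N) $$ (c, l) = (\<Sum>k\<in>{0..<length bs}. D $$ (c, k) * homogeneous_part (as ! l - bs ! k) (y l $ k))"
      using D cl by (auto simp: graded_map_def scalar_prod_def)
    also have "\<dots> = (\<Sum>k\<in>{0..<length bs}. homogeneous_part ?d (D $$ (c, k) * y l $ k))"
    proof (rule sum.cong[OF refl])
      fix k assume k: "k \<in> {0..<length bs}"
      have "homogeneous (bs ! k - cs ! c) (D $$ (c, k))" using D cl k by (auto simp: graded_map_def)
      from homogeneous_part_mult[OF this, of "as ! l - bs ! k"]
      show "D $$ (c, k) * homogeneous_part (as ! l - bs ! k) (y l $ k) = homogeneous_part ?d (D $$ (c, k) * y l $ k)"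
        by simp
    qed
    also have "\<dots> = homogeneous_part ?d ((D *\<^sub>v y l) $ c)"
      using D cl y(1)[OF cl(2)] by (auto simp: graded_map_def free_module_def scalar_prod_def keys_restrict_sum)
    also have "\<dots> = homogeneous_part ?d (M $$ (c, l))"
      using M cl by (auto simp: y(2)[symmetric] graded_map_def)
    also have "\<dots> = M $$ (c, l)" using M cl by (intro homogeneous_part_eq) (auto simp: graded_map_def)
    finally show "(D * ?N) $$ (c, l) = M $$ (c, l)" .
  qed (use D M in \<open>auto simp: graded_map_def\<close>)
  ultimately show ?thesis by blast
qed

lemma acyclic_complex_graded: "acyclic_complex V F D \<Longrightarrow> graded_map V (F (Suc i)) (F i) (D i)"
  by (simp add: acyclic_complex_def)

lemma acyclic_complex_exact:
  "acyclic_complex V F D \<Longrightarrow>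
    x \<in> bounds V F D (Suc i) \<longleftrightarrow> x \<in> free_module V (F (Suc i)) \<and> D i *\<^sub>v x = 0\<^sub>v (length (F i))"
  unfolding acyclic_complex_def by blast

lemma bounds_carrier:
  assumes "graded_map V (F (Suc i)) (F i) (D i)" "x \<in> bounds V F D i"
  shows "x \<in> free_module V (F i)"
  using assms graded_map_mult_vec by (auto simp: bounds_def)

lemma mat_eq_zeroI:
  fixes A :: "('v, 'k::field) mpoly mat"
  assumes A: "A \<in> carrier_mat n (length as)" and "\<And>x. x \<in> free_module V as \<Longrightarrow> A *\<^sub>v x = 0\<^sub>v n"
  shows "A = 0\<^sub>m n (length as)"
proof (rule eq_matI)
  fix i j assume ij: "i < dim_row (0\<^sub>m n (length as) :: ('v, 'k) mpoly mat)" "j < dim_col (0\<^sub>m n (length as) :: ('v, 'k) mpoly mat)"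
  then have "col A j = 0\<^sub>v n"
    using mat_mult_unit_vec[OF A, of j] assms(2)[OF unit_vec_free_module] by simp
  then have "col A j $ i = 0" using ij by simp
  then show "A $$ (i, j) = 0\<^sub>m n (length as) $$ (i, j)" using ij A by auto
qed (use A in auto)

lemma acyclic_complex_square_zero:
  fixes D :: "nat \<Rightarrow> ('v, 'k::field) mpoly mat"
  assumes "acyclic_complex V F D"
  shows "D i * D (Suc i) = 0\<^sub>m (length (F i)) (length (F (Suc (Suc i))))"
proof (rule mat_eq_zeroI)
  note c = graded_map_carrier[OF acyclic_complex_graded[OF assms]]
  show "D i * D (Suc i) \<in> carrier_mat (length (F i)) (length (F (Suc (Suc i))))"
    using c[of i] c[of "Suc i"] by auto
  fix x :: "('v, 'k) mpoly vec" assume x: "x \<in> free_module V (F (Suc (Suc i)))"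
  then have "D (Suc i) *\<^sub>v x \<in> bounds V F D (Suc i)" by (auto simp: bounds_def)
  then show "D i * D (Suc i) *\<^sub>v x = 0\<^sub>v (length (F i))"
    using acyclic_complex_exact[OF assms] assoc_mult_mat_vec[OF c[of i] c[of "Suc i"] free_module_carrier[OF x]] by simp
qed

text \<open>The comparison theorem: \<open>f i * DP i\<close> is lifted through \<open>DQ i\<close>,
  one homological degree after the other.\<close>

lemma chain_map_exists:
  fixes DP DQ :: "nat \<Rightarrow> ('v, 'k::field) mpoly mat"
  assumes P: "acyclic_complex V P DP" and Q: "acyclic_complex V Q DQ"
    and f0: "graded_map V (P 0) (Q 0) f0"
    and b0: "\<And>x. x \<in> bounds V P DP 0 \<Longrightarrow> f0 *\<^sub>v x \<in> bounds V Q DQ 0"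
  shows "\<exists>f. f 0 = f0 \<and> (\<forall>i. graded_map V (P i) (Q i) (f i) \<and> DQ i * f (Suc i) = f i * DP i)"
proof -
  note cP = acyclic_complex_graded[OF P] and cQ = acyclic_complex_graded[OF Q]
  \<comment> \<open>Preservation of boundaries is carried along because it is what the next lift
    requires. In degree 0 it is the assumption \<open>b0\<close>; afterwards boundaries are the
    cycles, and a commuting square sends cycles to cycles.\<close>
  let ?P = "\<lambda>i f. graded_map V (P i) (Q i) f \<and> (\<forall>x \<in> bounds V P DP i. f *\<^sub>v x \<in> bounds V Q DQ i)
     \<and> (i = 0 \<longrightarrow> f = f0)"
  have "\<exists>f. \<forall>i. ?P i (f i) \<and> DQ i * f (Suc i) = f i * DP i"
  proof (rule dependent_nat_choice)
    show "\<exists>f. ?P 0 f" using f0 b0 by blast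
    fix f i assume f: "?P i f"
    then have gf: "graded_map V (P i) (Q i) f" by blast
    have M: "graded_map V (P (Suc i)) (Q i) (f * DP i)"
      by (rule graded_map_mult[OF gf cP])
    have "\<exists>N. graded_map V (P (Suc i)) (Q (Suc i)) N \<and> DQ i * N = f * DP i"
    proof (rule graded_lift[OF cQ M])
      fix x :: "('v, 'k) mpoly vec" assume x: "x \<in> free_module V (P (Suc i))"
      have "f * DP i *\<^sub>v x = f *\<^sub>v (DP i *\<^sub>v x)"
        by (rule assoc_mult_mat_vec[OF graded_map_carrier[OF gf] graded_map_carrier[OF cP] free_module_carrier[OF x]])
      also have "\<dots> \<in> bounds V Q DQ i" using f x by (auto simp: bounds_def)
      finally show "f * DP i *\<^sub>v x \<in> (*\<^sub>v) (DQ i) ` free_module V (Q (Suc i))" by (simp add: bounds_def)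
    qed
    then obtain g where g: "graded_map V (P (Suc i)) (Q (Suc i)) g" "DQ i * g = f * DP i" by blast
    have "g *\<^sub>v x \<in> bounds V Q DQ (Suc i)" if "x \<in> bounds V P DP (Suc i)" for x
    proof -
      from that have x: "x \<in> free_module V (P (Suc i))" "DP i *\<^sub>v x = 0\<^sub>v (length (P i))"
        using acyclic_complex_exact[OF P] by auto
      have "DQ i *\<^sub>v (g *\<^sub>v x) = (DQ i * g) *\<^sub>v x"
        using assoc_mult_mat_vec[OF graded_map_carrier[OF cQ] graded_map_carrier[OF g(1)] free_module_carrier[OF x(1)]] by simp
      also have "\<dots> = f *\<^sub>v (DP i *\<^sub>v x)"
        unfolding g(2)
        by (rule assoc_mult_mat_vec[OF graded_map_carrier[OF gf] graded_map_carrier[OF cP] free_module_carrier[OF x(1)]])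
      also have "\<dots> = 0\<^sub>v (length (Q i))"
        unfolding x(2) using graded_map_carrier[OF gf] by auto
      finally show ?thesis
        using acyclic_complex_exact[OF Q] graded_map_mult_vec[OF g(1) x(1)] by simp
    qed
    with g show "\<exists>g. ?P (Suc i) g \<and> DQ i * g = f * DP i" by auto
  qed
  then show ?thesis by blast
qed

section \<open>Uniqueness of the ranks\<close>

text \<open>For matrices over the polynomial ring, this says that the matrix becomes zero over the
  residue field of the irrelevant ideal.\<close>

definition const_zero :: "('v, 'k::field) mpoly mat \<Rightarrow> bool" where
  "const_zero M \<longleftrightarrow> (\<forall>k < dim_row M. \<forall>l < dim_col M. Poly_Mapping.lookup (M $$ (k, l)) 0 = 0)"

lemma const_zero_mult:
  assumes "M \<in> carrier_mat n m" "N \<in> carrier_mat m p" "const_zero M \<or> const_zero N"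
  shows "const_zero (M * N)"
  using assms by (auto simp: const_zero_def scalar_prod_def lookup_sum lookup_mult_zero intro!: sum.neutral)

text \<open>Such a chain map is null-homotopic, and minimality makes the two terms \<open>h D\<close> and \<open>D h\<close> vanish
  modulo the variables.\<close>

lemma null_homotopic_const_zero:
  fixes D :: "nat \<Rightarrow> ('v, 'k::field) mpoly mat"
  assumes F: "acyclic_complex V F D" and min: "\<And>i. const_zero (D i)"
    and k: "\<And>i. graded_map V (F i) (F i) (k i)" "\<And>i. D i * k (Suc i) = k i * D i"
    and k0: "\<And>x. x \<in> free_module V (F 0) \<Longrightarrow> k 0 *\<^sub>v x \<in> bounds V F D 0"
  shows "const_zero (k i)"
proof -
  note gD = acyclic_complex_graded[OF F]
  note cD = graded_map_carrier[OF gD] and ck = graded_map_carrier[OF k(1)]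
  \<comment> \<open>In a homotopy, \<open>k i - D i * h\<close> is the previous homotopy composed
    with the previous differential, or zero for \<open>i = 0\<close>. The induction keeps two traces
    of that: its constant terms vanish, and it annihilates \<open>D i\<close>, which provides the
    next lift.\<close>
  have "\<exists>h. graded_map V (F i) (F (Suc i)) h \<and> const_zero (k i - D i * h) \<and> D i * h * D i = k i * D i"
  proof (induction i)
    case 0
    obtain h where h: "graded_map V (F 0) (F (Suc 0)) h" "D 0 * h = k 0"
      using graded_lift[OF gD k(1)] k0 unfolding bounds_def by blast
    have "const_zero (k 0 - D 0 * h)" using ck[of 0] by (simp add: h(2) const_zero_def lookup_minus)
    with h show ?case by auto
  next
    case (Suc i)
    then obtain h where h: "graded_map V (F i) (F (Suc i)) h" "D i * h * D i = k i * D i" by blast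
    note ch = graded_map_carrier[OF h(1)]
    let ?M = "k (Suc i) - h * D i"
    have M: "graded_map V (F (Suc i)) (F (Suc i)) ?M"
      by (rule graded_map_diff[OF k(1) graded_map_mult[OF h(1) gD]])
    have chD: "h * D i \<in> carrier_mat (length (F (Suc i))) (length (F (Suc i)))" using ch cD by auto
    have "D i * ?M = D i * k (Suc i) - D i * (h * D i)"
      by (rule mult_minus_distrib_mat[OF cD ck chD])
    also have "\<dots> = k i * D i - k i * D i"
      using assoc_mult_mat[OF cD ch cD] h(2) k(2) by simp
    also have "\<dots> = 0\<^sub>m (length (F i)) (length (F (Suc i)))"
      using ck[of i] cD[of i] by (intro minus_r_inv_mat) auto
    finally have DM: "D i * ?M = 0\<^sub>m (length (F i)) (length (F (Suc i)))" .
    have "\<exists>h'. graded_map V (F (Suc i)) (F (Suc (Suc i))) h' \<and> D (Suc i) * h' = ?M"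
    proof (rule graded_lift[OF gD M])
      fix x :: "('v, 'k) mpoly vec" assume x: "x \<in> free_module V (F (Suc i))"
      have "D i *\<^sub>v (?M *\<^sub>v x) = (D i * ?M) *\<^sub>v x"
        using assoc_mult_mat_vec[OF cD graded_map_carrier[OF M] free_module_carrier[OF x]] by simp
      also have "\<dots> = 0\<^sub>v (length (F i))" unfolding DM using free_module_carrier[OF x] by auto
      finally show "?M *\<^sub>v x \<in> (*\<^sub>v) (D (Suc i)) ` free_module V (F (Suc (Suc i)))"
        using acyclic_complex_exact[OF F] graded_map_mult_vec[OF M x] by (simp add: bounds_def)
    qed
    then obtain h' where h': "graded_map V (F (Suc i)) (F (Suc (Suc i))) h'" "D (Suc i) * h' = ?M" by blast
    have "k (Suc i) - ?M = h * D i"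
      using ck[of "Suc i"] chD by (intro eq_matI) auto
    moreover have "const_zero (h * D i)" using const_zero_mult[OF ch cD] min by blast
    moreover have "?M * D (Suc i) = k (Suc i) * D (Suc i) - h * D i * D (Suc i)"
      by (rule minus_mult_distrib_mat[OF ck chD cD])
    moreover have "h * D i * D (Suc i) = 0\<^sub>m (length (F (Suc i))) (length (F (Suc (Suc i))))"
      using assoc_mult_mat[OF ch cD cD] acyclic_complex_square_zero[OF F, of i] ch by simp
    moreover have "k (Suc i) * D (Suc i) - 0\<^sub>m (length (F (Suc i))) (length (F (Suc (Suc i)))) = k (Suc i) * D (Suc i)"
      using ck[of "Suc i"] cD[of "Suc i"] by (intro eq_matI) auto
    ultimately show ?case using h' by (intro exI[of _ h']) simp
  qed
  then obtain h where h: "graded_map V (F i) (F (Suc i)) h" "const_zero (k i - D i * h)" by blast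
  have "const_zero (D i * h)"
    using const_zero_mult[OF cD graded_map_carrier[OF h(1)]] min by blast
  with h(2) show ?thesis using ck[of i] cD[of i] graded_map_carrier[OF h(1)]
    by (auto simp: const_zero_def lookup_minus)
qed

text \<open>Padding the factors with zeros to square matrices makes the determinant of the product vanish
  if \<open>S\<close> is larger than \<open>T\<close>.\<close>

lemma identity_factorization_card_le:
  fixes A :: "'a \<Rightarrow> 'b \<Rightarrow> 'k::field" and B :: "'b \<Rightarrow> 'a \<Rightarrow> 'k"
  assumes "finite S" "finite T"
    and AB: "\<And>s s'. s \<in> S \<Longrightarrow> s' \<in> S \<Longrightarrow> (\<Sum>t\<in>T. A s t * B t s') = (if s = s' then 1 else 0)"
  shows "card S \<le> card T"
proof (rule ccontr)
  assume lt: "\<not> card S \<le> card T"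
  let ?n = "card S"
  obtain f where f: "bij_betw f {0..<?n} S" using ex_bij_betw_nat_finite[OF assms(1)] by blast
  obtain g where g: "bij_betw g {0..<card T} T" using ex_bij_betw_nat_finite[OF assms(2)] by blast
  let ?A = "mat ?n ?n (\<lambda>(i, j). if j < card T then A (f i) (g j) else 0)"
  let ?B = "mat ?n ?n (\<lambda>(i, j). if i < card T then B (g i) (f j) else 0)"
  have "?A * ?B = 1\<^sub>m ?n"
  proof (rule eq_matI)
    fix i j assume "i < dim_row (1\<^sub>m ?n :: 'k mat)" "j < dim_col (1\<^sub>m ?n :: 'k mat)"
    then have ij: "i < ?n" "j < ?n" by auto
    have "(?A * ?B) $$ (i, j) = (\<Sum>l\<in>{0..<?n}. if l < card T then A (f i) (g l) * B (g l) (f j) else 0)"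
      using ij by (auto simp: scalar_prod_def intro!: sum.cong)
    also have "\<dots> = (\<Sum>l\<in>{0..<card T}. A (f i) (g l) * B (g l) (f j))"
      using lt by (subst sum.inter_filter[symmetric]) (auto intro!: sum.cong)
    also have "\<dots> = (\<Sum>t\<in>T. A (f i) t * B t (f j))" by (rule sum.reindex_bij_betw[OF g])
    also have "\<dots> = (if f i = f j then 1 else 0)"
      using ij f by (intro AB) (auto simp: bij_betw_def)
    also have "\<dots> = 1\<^sub>m ?n $$ (i, j)"
      using ij f by (auto simp: bij_betw_def inj_on_def)
    finally show "(?A * ?B) $$ (i, j) = 1\<^sub>m ?n $$ (i, j)" .
  qed auto
  then have "det ?A * det ?B = 1" using det_mult[of ?A ?n ?B] by simp
  moreover have "det ?B = 0"
  proof -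
    \<comment> \<open>Row \<open>card T\<close> exists because \<open>card T < card S\<close>, and
      the padding makes it zero.\<close>
    have "?B = mat\<^sub>r ?n ?n (\<lambda>i. if i = card T then 0\<^sub>v ?n else row ?B i)"
      by (rule eq_matI) auto
    also have "det \<dots> = 0" using lt by (intro det_row_0) auto
    finally show ?thesis .
  qed
  ultimately show False by simp
qed

lemma count_list_card: "count_list xs j = card {l. l < length xs \<and> xs ! l = j}"
  by (simp add: count_list_eq_length_filter length_filter_conv_card eq_commute)

text \<open>The difference of \<open>g f\<close> and the identity is null-homotopic, so modulo the
  variables \<open>g\<close> is a left inverse of \<open>f\<close> in each homological degree.
  Constant entries can be nonzero only between basis vectors of equal degree, so the identity on the
  basis vectors of \<open>F i\<close> of degree \<open>j\<close> factors through those of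
  \<open>F' i\<close> of the same degree. Exchanging the two complexes turns the inequality into an
  equality.\<close>

lemma minimal_count_le:
  fixes D D' :: "nat \<Rightarrow> ('v, 'k::field) mpoly mat"
  assumes F: "acyclic_complex V F D" and F': "acyclic_complex V F' D'" and min: "\<And>i. const_zero (D i)"
    and f0: "graded_map V (F 0) (F' 0) f0" "\<And>x. x \<in> bounds V F D 0 \<Longrightarrow> f0 *\<^sub>v x \<in> bounds V F' D' 0"
    and g0: "graded_map V (F' 0) (F 0) g0" "\<And>x. x \<in> bounds V F' D' 0 \<Longrightarrow> g0 *\<^sub>v x \<in> bounds V F D 0"
    and gf0: "\<And>x. x \<in> free_module V (F 0) \<Longrightarrow> g0 *\<^sub>v (f0 *\<^sub>v x) - x \<in> bounds V F D 0"
  shows "count_list (F i) j \<le> count_list (F' i) j"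
proof -
  obtain f where f: "f 0 = f0" "\<And>i. graded_map V (F i) (F' i) (f i)" "\<And>i. D' i * f (Suc i) = f i * D i"
    using chain_map_exists[OF F F' f0] by blast
  obtain g where g: "g 0 = g0" "\<And>i. graded_map V (F' i) (F i) (g i)" "\<And>i. D i * g (Suc i) = g i * D' i"
    using chain_map_exists[OF F' F g0] by blast
  note cf = graded_map_carrier[OF f(2)] and cg = graded_map_carrier[OF g(2)]
  note cD = graded_map_carrier[OF acyclic_complex_graded[OF F]]
  note cD' = graded_map_carrier[OF acyclic_complex_graded[OF F']]
  define k where "k i = g i * f i - 1\<^sub>m (length (F i))" for i
  have cgf: "g i * f i \<in> carrier_mat (length (F i)) (length (F i))" for i
    by (rule mult_carrier_mat[OF cg cf])
  have gk: "graded_map V (F i) (F i) (k i)" for i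
    unfolding k_def using f(2) g(2) by (intro graded_map_diff graded_map_mult graded_map_one)
  have kD: "D i * k (Suc i) = k i * D i" for i
  proof -
    have "D i * k (Suc i) = D i * (g (Suc i) * f (Suc i)) - D i"
      unfolding k_def using mult_minus_distrib_mat[OF cD cgf one_carrier_mat] right_mult_one_mat[OF cD] by simp
    also have "D i * (g (Suc i) * f (Suc i)) = D i * g (Suc i) * f (Suc i)"
      by (rule assoc_mult_mat[OF cD cg cf, symmetric])
    also have "\<dots> = g i * (D' i * f (Suc i))"
      unfolding g(3) by (rule assoc_mult_mat[OF cg cD' cf])
    also have "\<dots> = g i * f i * D i"
      unfolding f(3) by (rule assoc_mult_mat[OF cg cf cD, symmetric])
    also have "g i * f i * D i - D i = k i * D i"
      unfolding k_def using minus_mult_distrib_mat[OF cgf one_carrier_mat cD] left_mult_one_mat[OF cD] by simp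
    finally show ?thesis .
  qed
  have k0: "k 0 *\<^sub>v x \<in> bounds V F D 0" if x: "x \<in> free_module V (F 0)" for x
  proof -
    have "k 0 *\<^sub>v x = g 0 * f 0 *\<^sub>v x - x"
      unfolding k_def using minus_mult_distrib_mat_vec[OF cgf one_carrier_mat free_module_carrier[OF x]]
        one_mult_mat_vec[OF free_module_carrier[OF x]] by simp
    also have "\<dots> = g0 *\<^sub>v (f0 *\<^sub>v x) - x"
      using assoc_mult_mat_vec[OF cg cf free_module_carrier[OF x]] f(1) g(1) by simp
    finally show ?thesis using gf0[OF x] by simp
  qed
  have cz: "const_zero (k i)"
    by (rule null_homotopic_const_zero[OF F min gk kD k0])
  let ?S = "{l. l < length (F i) \<and> F i ! l = j}" and ?T = "{l. l < length (F' i) \<and> F' i ! l = j}"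
  let ?A = "\<lambda>s t. Poly_Mapping.lookup (g i $$ (s, t)) 0" and ?B = "\<lambda>t s. Poly_Mapping.lookup (f i $$ (t, s)) 0"
  have "card ?S \<le> card ?T"
  proof (rule identity_factorization_card_le)
    fix s s' assume s: "s \<in> ?S" "s' \<in> ?S"
    have const: "Poly_Mapping.lookup p 0 = 0" if "homogeneous e p" "e \<noteq> 0" for e and p :: "('v, 'k) mpoly"
      using that by (force simp: homogeneous_def in_keys_iff)
    \<comment> \<open>Intermediate basis vectors of degree other than \<open>j\<close> contribute
      nothing, so the sum over \<open>?T\<close> is a full entry of the matrix product modulo the
      variables.\<close>
    have zero: "?A s t = 0" if "t < length (F' i)" "F' i ! t \<noteq> j" for t
    proof (rule const)
      show "homogeneous (F' i ! t - F i ! s) (g i $$ (s, t))" using g(2)[of i] s that by (auto simp: graded_map_def)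
    qed (use s that in auto)
    have "(\<Sum>t\<in>?T. ?A s t * ?B t s') = (\<Sum>t\<in>{0..<length (F' i)}. ?A s t * ?B t s')"
      by (rule sum.mono_neutral_left) (use zero in auto)
    also have "\<dots> = Poly_Mapping.lookup ((g i * f i) $$ (s, s')) 0"
      using cf[of i] cg[of i] s by (auto simp: scalar_prod_def lookup_sum lookup_mult_zero)
    also have "\<dots> = Poly_Mapping.lookup ((1\<^sub>m (length (F i)) :: ('v, 'k) mpoly mat) $$ (s, s')) 0"
      using cz s cgf[of i] by (auto simp: const_zero_def k_def lookup_minus)
    also have "\<dots> = (if s = s' then 1 else 0)" using s by simp
    finally show "(\<Sum>t\<in>?T. ?A s t * ?B t s') = (if s = s' then 1 else 0)" .
  qed auto
  then show ?thesis by (simp add: count_list_card)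
qed

section \<open>Comparison with an arbitrary minimal resolution of the same quotient\<close>

lemma graded_free_resolution_acyclic:
  fixes D :: "nat \<Rightarrow> ('v, 'k::field) mpoly mat"
  assumes "graded_free_resolution V I F \<epsilon> D"
  shows "acyclic_complex V F D" "bounds V F D 0 = {x \<in> free_module V (F 0). \<epsilon> \<bullet> x \<in> I}"
  using assms unfolding graded_free_resolution_def acyclic_complex_def bounds_def by blast+

lemma homogeneous_part_monomial_ideal:
  "f \<in> monomial_ideal V M \<Longrightarrow> keys_restrict P f \<in> monomial_ideal V M"
  by (auto simp: monomial_ideal_def)

lemma minimal_const_zero:
  assumes "minimal_graded_free_resolution V I F \<epsilon> D"
  shows "const_zero (D i)"
proof -
  have "D i \<in> carrier_mat (length (F i)) (length (F (Suc i)))"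
    using assms by (simp add: minimal_graded_free_resolution_def graded_free_resolution_def graded_map_def)
  then show ?thesis
    using assms unfolding minimal_graded_free_resolution_def const_zero_def
    by (auto intro: irrelevant_ideal_lookup_zero)
qed

text \<open>The identity of the quotient lifts in degree 0 to \<open>f0\<close>, which is
  \<open>\<epsilon>\<close> written as a row, and in the other direction to \<open>g0\<close>, which
  sends \<open>1\<close> to a preimage \<open>y\<close> of its class. Monomiality enters because the
  ideal must contain the homogeneous parts of its elements.\<close>

lemma count_list_minimal_resolution:
  fixes V :: "'v set" and M :: "('v \<Rightarrow>\<^sub>0 nat) set"
  defines "I \<equiv> monomial_ideal V M :: ('v, 'k::field) mpoly set"
  assumes F: "minimal_graded_free_resolution V I F (vec 1 (\<lambda>_. 1)) D" "F 0 = [0]"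
    and F': "minimal_graded_free_resolution V I F' \<epsilon> D'"
  shows "count_list (F' i) j = count_list (F i) j"
proof -
  let ?e = "vec 1 (\<lambda>_. 1) :: ('v, 'k) mpoly vec"
  have R: "graded_free_resolution V I F ?e D" and R': "graded_free_resolution V I F' \<epsilon> D'"
    using F(1) F' by (auto simp: minimal_graded_free_resolution_def)
  note A = graded_free_resolution_acyclic[OF R] and A' = graded_free_resolution_acyclic[OF R']
  note fc = free_module_carrier
  have add: "f + g \<in> I" if "f \<in> I" "g \<in> I" for f g using that unfolding I_def by (rule monomial_ideal_add)
  have mult: "f * g \<in> I" if "f \<in> poly_ring V" "g \<in> I" for f g
    using that unfolding I_def by (rule monomial_ideal_mult)
  have sub: "f \<in> poly_ring V" if "f \<in> I" for f using that monomial_ideal_subset by (auto simp: I_def)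
  have neg: "f - g \<in> I" if "g - f \<in> I" for f g
    using mult[OF _ that, of "- 1"] by simp
  let ?n = "length (F' 0)"
  have eps: "\<epsilon> \<in> free_module V (F' 0)" "\<And>l. l < ?n \<Longrightarrow> homogeneous (F' 0 ! l) (\<epsilon> $ l)"
    "\<And>f. f \<in> poly_ring V \<Longrightarrow> \<exists>x\<in>free_module V (F' 0). f - \<epsilon> \<bullet> x \<in> I"
    using R' by (auto simp: graded_free_resolution_def)
  have fm0: "x \<in> free_module V (F 0) \<longleftrightarrow> x \<in> carrier_vec 1 \<and> x $ 0 \<in> poly_ring V" for x :: "('v, 'k) mpoly vec"
    by (simp add: F(2) free_module_def)
  have b0: "x \<in> bounds V F D 0 \<longleftrightarrow> x \<in> carrier_vec 1 \<and> x $ 0 \<in> I" for x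
    using sub by (auto simp: A(2) fm0 scalar_prod_def)
  have b0': "x \<in> bounds V F' D' 0 \<longleftrightarrow> x \<in> free_module V (F' 0) \<and> \<epsilon> \<bullet> x \<in> I" for x
    by (simp add: A'(2))
  have eps_pr: "\<epsilon> \<bullet> x \<in> poly_ring V" if "x \<in> free_module V (F' 0)" for x
    using that eps(1) by (intro scalar_prod_poly_ring) (auto simp: free_module_def)
  define f0 where "f0 = mat 1 ?n (\<lambda>(k, l). \<epsilon> $ l)"
  have gf0: "graded_map V (F' 0) (F 0) f0"
    using eps by (auto simp: graded_map_def f0_def F(2) free_module_def)
  have f0: "(f0 *\<^sub>v x) $ 0 = \<epsilon> \<bullet> x" if "x \<in> free_module V (F' 0)" for x
    using fc[OF that] by (simp add: f0_def scalar_prod_def)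
  have f0c: "f0 *\<^sub>v x \<in> carrier_vec 1" for x :: "('v, 'k) mpoly vec"
    by (rule carrier_vecI) (simp add: f0_def)
  obtain x0 where x0: "x0 \<in> free_module V (F' 0)" "1 - \<epsilon> \<bullet> x0 \<in> I" using eps(3)[OF poly_ring_one] by blast
  \<comment> \<open>The preimage \<open>x0\<close> of the class of \<open>1\<close> may be
    inhomogeneous. This choice of components makes \<open>g0\<close> degree-preserving and turns
    \<open>\<epsilon> \<bullet> y\<close> into the degree 0 part of
    \<open>\<epsilon> \<bullet> x0\<close>.\<close>
  define y where "y = vec ?n (\<lambda>k. homogeneous_part (0 - F' 0 ! k) (x0 $ k))"
  have y: "y \<in> free_module V (F' 0)" using x0(1) by (auto simp: y_def free_module_def)
  have "\<epsilon> \<bullet> y = homogeneous_part 0 (\<epsilon> \<bullet> x0)"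
  proof -
    have "\<epsilon> \<bullet> y = (\<Sum>k\<in>{0..<?n}. \<epsilon> $ k * homogeneous_part (0 - F' 0 ! k) (x0 $ k))"
      by (simp add: scalar_prod_def y_def)
    also have "\<dots> = (\<Sum>k\<in>{0..<?n}. homogeneous_part 0 (\<epsilon> $ k * x0 $ k))"
    proof (rule sum.cong[OF refl])
      fix k assume "k \<in> {0..<?n}"
      then show "\<epsilon> $ k * homogeneous_part (0 - F' 0 ! k) (x0 $ k) = homogeneous_part 0 (\<epsilon> $ k * x0 $ k)"
        using homogeneous_part_mult[OF eps(2), of k "0 - F' 0 ! k" "x0 $ k"] by simp
    qed
    also have "\<dots> = homogeneous_part 0 (\<epsilon> \<bullet> x0)"
      using fc[OF x0(1)] by (simp add: scalar_prod_def keys_restrict_sum)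
    finally show ?thesis .
  qed
  then have "1 - \<epsilon> \<bullet> y = homogeneous_part 0 (1 - \<epsilon> \<bullet> x0)"
    by (simp only: keys_restrict_diff homogeneous_part_eq[OF homogeneous_one])
  then have y1: "1 - \<epsilon> \<bullet> y \<in> I"
    using x0(2) homogeneous_part_monomial_ideal by (simp add: I_def)
  define g0 where "g0 = mat ?n 1 (\<lambda>(k, l). y $ k)"
  have gg0: "graded_map V (F 0) (F' 0) g0"
    using y by (auto simp: graded_map_def g0_def F(2) free_module_def) (simp add: y_def)
  have g0: "g0 *\<^sub>v z = (z $ 0) \<cdot>\<^sub>v y" if "z \<in> carrier_vec 1" for z
    using that fc[OF y] by (intro eq_vecI) (auto simp: g0_def scalar_prod_def mult.commute)
  have eg0: "\<epsilon> \<bullet> (g0 *\<^sub>v z) = z $ 0 * (\<epsilon> \<bullet> y)" if "z \<in> carrier_vec 1" for z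
    using g0[OF that] fc[OF eps(1)] fc[OF y] by simp
  have f0b: "f0 *\<^sub>v x \<in> bounds V F D 0" if "x \<in> bounds V F' D' 0" for x
    using that f0 f0c by (simp add: b0 b0')
  have g0b: "g0 *\<^sub>v z \<in> bounds V F' D' 0" if "z \<in> bounds V F D 0" for z
  proof -
    have z: "z \<in> free_module V (F 0)" "z \<in> carrier_vec 1" "z $ 0 \<in> I"
      using that sub by (auto simp: b0 fm0)
    have "\<epsilon> \<bullet> (g0 *\<^sub>v z) \<in> I"
      unfolding eg0[OF z(2)] using mult[OF eps_pr[OF y] z(3)] by (simp add: mult.commute)
    then show ?thesis using graded_map_mult_vec[OF gg0 z(1)] by (simp add: b0')
  qed
  have fg: "f0 *\<^sub>v (g0 *\<^sub>v z) - z \<in> bounds V F D 0" if z: "z \<in> free_module V (F 0)" for z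
  proof -
    have "(f0 *\<^sub>v (g0 *\<^sub>v z) - z) $ 0 = z $ 0 * (\<epsilon> \<bullet> y) - z $ 0"
      using z f0[OF graded_map_mult_vec[OF gg0 z]] eg0 by (auto simp: fm0)
    also have "\<dots> \<in> I"
      using neg[OF mult[OF _ y1, of "z $ 0", unfolded right_diff_distrib mult_1_right]] z[unfolded fm0]
      by (metis mult_1_right mult y1 neg right_diff_distrib)
    finally show ?thesis using z f0c by (simp add: b0 fm0)
  qed
  have gf: "g0 *\<^sub>v (f0 *\<^sub>v x) - x \<in> bounds V F' D' 0" if x: "x \<in> free_module V (F' 0)" for x
  proof -
    have m: "g0 *\<^sub>v (f0 *\<^sub>v x) \<in> free_module V (F' 0)"
      by (intro graded_map_mult_vec[OF gg0] graded_map_mult_vec[OF gf0] x)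
    have "\<epsilon> \<bullet> (g0 *\<^sub>v (f0 *\<^sub>v x) - x) = (\<epsilon> \<bullet> x) * (\<epsilon> \<bullet> y) - \<epsilon> \<bullet> x"
      using scalar_prod_minus_distrib[OF fc[OF eps(1)] fc[OF m] fc[OF x]] eg0[OF f0c] f0[OF x] by simp
    also have "\<dots> \<in> I"
      by (metis mult_1_right mult y1 neg right_diff_distrib eps_pr[OF x])
    finally show ?thesis using free_module_diff[OF m x] by (simp add: b0')
  qed
  have cz: "const_zero (D i)" "const_zero (D' i)" for i
    using minimal_const_zero[OF F(1)] minimal_const_zero[OF F'] by auto
  show ?thesis
    by (intro antisym minimal_count_le[OF A'(1) A(1) cz(2) gf0 f0b gg0 g0b gf]
        minimal_count_le[OF A(1) A'(1) cz(1) gg0 g0b gf0 f0b fg])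
qed

section \<open>Mapping cones\<close>

lemma free_module_append:
  "x \<in> free_module V (as @ bs) \<longleftrightarrow> (\<exists>a\<in>free_module V as. \<exists>b\<in>free_module V bs. x = a @\<^sub>v b)"
proof
  assume x: "x \<in> free_module V (as @ bs)"
  then have "x = vec_first x (length as) @\<^sub>v vec_last x (length bs)"
    by (simp add: free_module_def)
  moreover have "vec_first x (length as) \<in> free_module V as" "vec_last x (length bs) \<in> free_module V bs"
    using x by (auto simp: free_module_def vec_first_def vec_last_def)
  ultimately show "\<exists>a\<in>free_module V as. \<exists>b\<in>free_module V bs. x = a @\<^sub>v b" by blast
qed (auto simp: free_module_def)

lemma zero_vec_append: "0\<^sub>v (n + m) = 0\<^sub>v n @\<^sub>v 0\<^sub>v m"
  by (rule eq_vecI) auto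

lemma mult_mat_uminus_vec:
  fixes A :: "'a::ring mat"
  shows "A \<in> carrier_mat n m \<Longrightarrow> v \<in> carrier_vec m \<Longrightarrow> A *\<^sub>v (- v) = - (A *\<^sub>v v)"
  by (intro eq_vecI) auto

text \<open>By \<open>inj\<close>, the map induced by \<open>f\<close> between the modules resolved
  by \<open>P\<close> and \<open>Q\<close> is injective. This yields exactness in homological degree
  1 of the cone, where exactness of \<open>P\<close> says nothing. The cone then resolves the
  cokernel, whose relations are given by the last clause.\<close>

lemma mapping_cone:
  fixes DP DQ f :: "nat \<Rightarrow> ('v, 'k::field) mpoly mat"
  assumes P: "acyclic_complex V P DP" and Q: "acyclic_complex V Q DQ"
    and f: "\<And>i. graded_map V (P i) (Q i) (f i)" "\<And>i. DQ i * f (Suc i) = f i * DP i"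
    and inj: "\<And>x. x \<in> free_module V (P 0) \<Longrightarrow> f 0 *\<^sub>v x \<in> bounds V Q DQ 0 \<Longrightarrow> x \<in> bounds V P DP 0"
  defines "G \<equiv> \<lambda>i. Q i @ (case i of 0 \<Rightarrow> [] | Suc j \<Rightarrow> P j)"
  obtains DG where "acyclic_complex V G DG"
    "bounds V G DG 0 = {z + f 0 *\<^sub>v x | z x. z \<in> bounds V Q DQ 0 \<and> x \<in> free_module V (P 0)}"
proof -
  define P' where "P' i = (case i of 0 \<Rightarrow> [] | Suc j \<Rightarrow> P j)" for i
  \<comment> \<open>The sign makes consecutive differentials of the cone compose to zero, given that
    \<open>f\<close> commutes with the differentials. In degree 0 the target is the zero module,
    hence a matrix without rows.\<close>
  define D' where "D' i = (case i of 0 \<Rightarrow> 0\<^sub>m 0 (length (P 0)) | Suc j \<Rightarrow> - DP j)" for i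
  define DG where "DG i = four_block_mat (DQ i) (f i) (0\<^sub>m (length (P' i)) (length (Q (Suc i)))) (D' i)" for i
  have G: "G i = Q i @ P' i" for i by (simp add: G_def P'_def)
  have P'_simps: "P' 0 = []" "P' (Suc i) = P i" and D'_simps: "D' 0 = 0\<^sub>m 0 (length (P 0))" "D' (Suc i) = - DP i" for i
    by (simp_all add: P'_def D'_def)
  note gP = acyclic_complex_graded[OF P] and gQ = acyclic_complex_graded[OF Q]
  note cP = graded_map_carrier[OF gP] and cQ = graded_map_carrier[OF gQ] and cf = graded_map_carrier[OF f(1)]
  note fc = free_module_carrier
  have gD': "graded_map V (P i) (P' i) (D' i)" for i
    by (cases i) (use gP in \<open>auto simp: P'_simps D'_simps graded_map_uminus\<close>, simp add: graded_map_def)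
  note cD' = graded_map_carrier[OF gD']
  have gDG: "graded_map V (G (Suc i)) (G i) (DG i)" for i
    using gQ[of i] f(1)[of i] gD'[of i]
    by (auto simp: graded_map_def G P'_simps DG_def nth_append)
  have DG: "DG i *\<^sub>v (a @\<^sub>v b) = (DQ i *\<^sub>v a + f i *\<^sub>v b) @\<^sub>v (D' i *\<^sub>v b)"
    if "a \<in> free_module V (Q (Suc i))" "b \<in> free_module V (P i)" for a b i
  proof -
    have "0\<^sub>m (length (P' i)) (length (Q (Suc i))) *\<^sub>v a + D' i *\<^sub>v b = D' i *\<^sub>v b"
      using fc[OF that(1)] cD'[of i] by (intro eq_vecI) auto
    then show ?thesis unfolding DG_def
      using four_block_mat_mult_vec[OF cQ cf zero_carrier_mat cD' fc[OF that(1)] fc[OF that(2)]] by simp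
  qed
  have comm: "DQ i *\<^sub>v (f (Suc i) *\<^sub>v c) = f i *\<^sub>v (DP i *\<^sub>v c)" if "c \<in> free_module V (P (Suc i))" for c i
    using assoc_mult_mat_vec[OF cQ cf fc[OF that]] assoc_mult_mat_vec[OF cf cP fc[OF that]] f(2)[of i] by simp
  have ker: "x \<in> bounds V G DG (Suc i)" if x: "x \<in> free_module V (G (Suc i))" "DG i *\<^sub>v x = 0\<^sub>v (length (G i))" for x i
  proof -
    obtain a b where ab: "x = a @\<^sub>v b" "a \<in> free_module V (Q (Suc i))" "b \<in> free_module V (P i)"
      using x(1) by (auto simp: G P'_simps free_module_append)
    have "DQ i *\<^sub>v a + f i *\<^sub>v b \<in> carrier_vec (length (Q i))"
      using mult_mat_vec_carrier[OF cQ fc[OF ab(2)]] mult_mat_vec_carrier[OF cf fc[OF ab(3)]] by simp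
    then have eqs: "DQ i *\<^sub>v a + f i *\<^sub>v b = 0\<^sub>v (length (Q i))" "D' i *\<^sub>v b = 0\<^sub>v (length (P' i))"
      using x(2) unfolding ab(1) DG[OF ab(2,3)] G by (simp_all add: zero_vec_append append_vec_eq)
    \<comment> \<open>For a cycle \<open>(a, b)\<close> of the cone, \<open>b = D c\<close> is a
      boundary of \<open>P\<close>; then \<open>a + f c\<close> is a cycle of \<open>Q\<close>,
      hence some \<open>D d\<close>, and \<open>(d, - c)\<close> is mapped to
      \<open>(a, b)\<close>.\<close>
    have "b \<in> bounds V P DP i"
    proof (cases i)
      case 0
      have "f 0 *\<^sub>v b = DQ 0 *\<^sub>v (- a)"
        unfolding mult_mat_uminus_vec[OF cQ fc[OF ab(2)[unfolded 0]]]
      proof (rule eq_vecI)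
        fix k assume k: "k < dim_vec (- (DQ 0 *\<^sub>v a))"
        have "(DQ 0 *\<^sub>v a + f 0 *\<^sub>v b) $ k = 0" using eqs(1) k cQ[of 0] by (simp add: 0)
        then show "(f 0 *\<^sub>v b) $ k = (- (DQ 0 *\<^sub>v a)) $ k"
          using k cQ[of 0] cf[of 0] by (simp add: eq_neg_iff_add_eq_0 add.commute)
      qed (use cQ[of 0] cf[of 0] in auto)
      then have "f 0 *\<^sub>v b \<in> bounds V Q DQ 0"
        using free_module_uminus[OF ab(2)] by (auto simp: bounds_def 0)
      then show ?thesis using inj ab(3) by (simp add: 0)
    next
      case (Suc j)
      have "DP j *\<^sub>v b = - (- DP j *\<^sub>v b)"
        using fc[OF ab(3)] cP[of j] by (intro eq_vecI) (auto simp: Suc)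
      also have "\<dots> = 0\<^sub>v (length (P j))" using eqs(2) by (simp add: Suc P'_simps D'_simps)
      finally show ?thesis using ab(3) by (simp add: Suc acyclic_complex_exact[OF P])
    qed
    then obtain c where c: "b = DP i *\<^sub>v c" "c \<in> free_module V (P (Suc i))" by (auto simp: bounds_def)
    have fc_mod: "f (Suc i) *\<^sub>v c \<in> free_module V (Q (Suc i))" by (rule graded_map_mult_vec[OF f(1) c(2)])
    have "DQ i *\<^sub>v (a + f (Suc i) *\<^sub>v c) = 0\<^sub>v (length (Q i))"
      using mult_add_distrib_mat_vec[OF cQ fc[OF ab(2)] fc[OF fc_mod]] comm[OF c(2)] eqs(1) c(1) by simp
    then have "a + f (Suc i) *\<^sub>v c \<in> bounds V Q DQ (Suc i)"
      using free_module_add[OF ab(2) fc_mod] by (simp add: acyclic_complex_exact[OF Q])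
    then obtain d where d: "a + f (Suc i) *\<^sub>v c = DQ (Suc i) *\<^sub>v d" "d \<in> free_module V (Q (Suc (Suc i)))"
      by (auto simp: bounds_def)
    have "DG (Suc i) *\<^sub>v (d @\<^sub>v (- c)) = (DQ (Suc i) *\<^sub>v d + f (Suc i) *\<^sub>v (- c)) @\<^sub>v (- DP i *\<^sub>v (- c))"
      using DG[OF d(2) free_module_uminus[OF c(2)]] by (simp add: D'_simps)
    also have "- DP i *\<^sub>v (- c) = b"
      using c fc[OF c(2)] cP[of i] by (intro eq_vecI) auto
    also have "DQ (Suc i) *\<^sub>v d + f (Suc i) *\<^sub>v (- c) = a"
      unfolding d(1)[symmetric] mult_mat_uminus_vec[OF cf fc[OF c(2)]]
      using fc[OF ab(2)] fc[OF fc_mod] by (intro eq_vecI) auto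
    finally show ?thesis
      unfolding bounds_def ab(1)
      by (intro image_eqI[of _ _ "d @\<^sub>v (- c)"])
        (use d(2) free_module_uminus[OF c(2)] in \<open>auto simp: G P'_simps free_module_append\<close>)
  qed
  have im: "x \<in> free_module V (G (Suc i))" "DG i *\<^sub>v x = 0\<^sub>v (length (G i))"
    if x: "x \<in> bounds V G DG (Suc i)" for x i
  proof -
    show "x \<in> free_module V (G (Suc i))" by (rule bounds_carrier[OF gDG x])
    obtain d c where dc: "x = DG (Suc i) *\<^sub>v (d @\<^sub>v c)" "d \<in> free_module V (Q (Suc (Suc i)))" "c \<in> free_module V (P (Suc i))"
      using x by (auto simp: bounds_def G P'_simps free_module_append)
    define a where "a = DQ (Suc i) *\<^sub>v d + f (Suc i) *\<^sub>v c"
    define b where "b = - DP i *\<^sub>v c"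
    have x': "x = a @\<^sub>v b" using DG[OF dc(2,3)] by (simp add: dc(1) a_def b_def D'_simps)
    have Qd: "DQ (Suc i) *\<^sub>v d \<in> free_module V (Q (Suc i))" and fcm: "f (Suc i) *\<^sub>v c \<in> free_module V (Q (Suc i))"
      and Pc: "DP i *\<^sub>v c \<in> free_module V (P i)"
      using graded_map_mult_vec[OF gQ dc(2)] graded_map_mult_vec[OF f(1) dc(3)] graded_map_mult_vec[OF gP dc(3)] by auto
    have b': "b = - (DP i *\<^sub>v c)" unfolding b_def using fc[OF dc(3)] cP[of i] by (intro uminus_mult_mat_vec) auto
    have a: "a \<in> free_module V (Q (Suc i))" unfolding a_def by (rule free_module_add[OF Qd fcm])
    have b: "b \<in> free_module V (P i)" unfolding b' by (rule free_module_uminus[OF Pc])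
    have "DQ (Suc i) *\<^sub>v d \<in> bounds V Q DQ (Suc i)" using dc(2) by (auto simp: bounds_def)
    then have 0: "DQ i *\<^sub>v (DQ (Suc i) *\<^sub>v d) = 0\<^sub>v (length (Q i))" by (simp add: acyclic_complex_exact[OF Q])
    have "DQ i *\<^sub>v a + f i *\<^sub>v b = 0\<^sub>v (length (Q i)) + f i *\<^sub>v (DP i *\<^sub>v c) + - (f i *\<^sub>v (DP i *\<^sub>v c))"
      unfolding a_def b' mult_add_distrib_mat_vec[OF cQ fc[OF Qd] fc[OF fcm]] 0 comm[OF dc(3)]
        mult_mat_uminus_vec[OF cf fc[OF Pc]] ..
    also have "\<dots> = 0\<^sub>v (length (Q i))" using cf[of i] by (intro eq_vecI) auto
    finally have 1: "DQ i *\<^sub>v a + f i *\<^sub>v b = 0\<^sub>v (length (Q i))" .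
    have 2: "D' i *\<^sub>v b = 0\<^sub>v (length (P' i))"
    proof (cases i)
      case 0
      then show ?thesis by (auto simp: P'_simps D'_simps)
    next
      case (Suc j)
      have "DP i *\<^sub>v c \<in> bounds V P DP i" using dc(3) by (auto simp: bounds_def)
      then have "DP j *\<^sub>v (DP i *\<^sub>v c) = 0\<^sub>v (length (P j))" by (simp add: Suc acyclic_complex_exact[OF P])
      moreover have "D' i *\<^sub>v b = DP j *\<^sub>v (DP i *\<^sub>v c)"
      proof -
        have Pc': "DP i *\<^sub>v c \<in> carrier_vec (length (P (Suc j)))" using fc[OF Pc] by (simp add: Suc)
        have "D' i *\<^sub>v b = - (DP j *\<^sub>v b)"
          using fc[OF b] cP[of j] unfolding Suc D'_simps by (intro uminus_mult_mat_vec) auto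
        also have "\<dots> = DP j *\<^sub>v (DP i *\<^sub>v c)"
          unfolding b' mult_mat_uminus_vec[OF cP Pc'] by simp
        finally show ?thesis .
      qed
      ultimately show ?thesis by (simp add: Suc P'_simps)
    qed
    show "DG i *\<^sub>v x = 0\<^sub>v (length (G i))"
      unfolding x' DG[OF a b] 1 2 by (simp add: G zero_vec_append)
  qed
  have 1: "acyclic_complex V G DG"
    unfolding acyclic_complex_def
  proof (intro conjI allI equalityI subsetI)
    fix x i assume "x \<in> {x \<in> free_module V (G (Suc i)). DG i *\<^sub>v x = 0\<^sub>v (length (G i))}"
    then show "x \<in> bounds V G DG (Suc i)" by (intro ker) auto
  next
    fix x i assume "x \<in> bounds V G DG (Suc i)"
    then show "x \<in> {x \<in> free_module V (G (Suc i)). DG i *\<^sub>v x = 0\<^sub>v (length (G i))}"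
      using im by auto
  qed (rule gDG)
  have DG0: "DG 0 *\<^sub>v (a @\<^sub>v b) = DQ 0 *\<^sub>v a + f 0 *\<^sub>v b"
    if "a \<in> free_module V (Q (Suc 0))" "b \<in> free_module V (P 0)" for a b
    unfolding DG[OF that] by (rule eq_vecI) (auto simp: D'_simps)
  have "bounds V G DG 0 = {z + f 0 *\<^sub>v x | z x. z \<in> bounds V Q DQ 0 \<and> x \<in> free_module V (P 0)}" (is "?L = ?R")
  proof (intro equalityI subsetI)
    fix x assume "x \<in> ?L"
    then obtain y where y: "x = DG 0 *\<^sub>v y" "y \<in> free_module V (Q (Suc 0) @ P 0)"
      unfolding bounds_def G P'_simps by (rule imageE)
    then obtain a b where ab: "y = a @\<^sub>v b" "a \<in> free_module V (Q (Suc 0))" "b \<in> free_module V (P 0)"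
      unfolding free_module_append by (elim bexE)
    have "x = DQ 0 *\<^sub>v a + f 0 *\<^sub>v b" by (simp only: y(1) ab(1) DG0[OF ab(2,3)])
    moreover have "DQ 0 *\<^sub>v a \<in> bounds V Q DQ 0" using ab(2) unfolding bounds_def by (rule imageI)
    ultimately show "x \<in> ?R" using ab(3) by (intro CollectI exI conjI)
  next
    fix x assume "x \<in> ?R"
    then obtain z b where z: "x = z + f 0 *\<^sub>v b" "z \<in> bounds V Q DQ 0" "b \<in> free_module V (P 0)"
      by (elim CollectE exE conjE)
    then obtain a where a: "z = DQ 0 *\<^sub>v a" "a \<in> free_module V (Q (Suc 0))"
      unfolding bounds_def by (elim imageE)
    have "x = DG 0 *\<^sub>v (a @\<^sub>v b)" by (simp only: z(1) a(1) DG0[OF a(2) z(3)])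
    moreover have "a @\<^sub>v b \<in> free_module V (G (Suc 0))"
      unfolding G P'_simps free_module_append by (rule bexI[OF bexI[OF refl z(3)] a(2)])
    ultimately show "x \<in> ?L" unfolding bounds_def by (rule image_eqI)
  qed
  with 1 show thesis by (rule that)
qed

text \<open>A twist preserves all differences of degrees, and the underlying modules depend only on
  the lengths of the lists.\<close>

lemma acyclic_complex_shift:
  fixes D :: "nat \<Rightarrow> ('v, 'k::field) mpoly mat"
  assumes "acyclic_complex V F D"
  shows "acyclic_complex V (\<lambda>i. map ((+) e) (F i)) D"
    and "bounds V (\<lambda>i. map ((+) e) (F i)) D i = bounds V F D i"
proof -
  have fm: "free_module V (map ((+) e) as) = (free_module V as :: ('v, 'k) mpoly vec set)" for as by (simp add: free_module_def)
  then show "bounds V (\<lambda>i. map ((+) e) (F i)) D i = bounds V F D i" by (simp add: bounds_def)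
  show "acyclic_complex V (\<lambda>i. map ((+) e) (F i)) D"
    using assms by (simp add: acyclic_complex_def fm bounds_def graded_map_def)
qed

text \<open>The shift \<open>s\<close> is the degree of the generators of \<open>I\<close>, and \<open>b i\<close> is the rank in homological
  degree \<open>i + 1\<close>.\<close>

definition linear_resolution :: "'v set \<Rightarrow> ('v, 'k::field) mpoly set \<Rightarrow> int \<Rightarrow> (nat \<Rightarrow> nat) \<Rightarrow> bool" where
  "linear_resolution V I s b \<longleftrightarrow> (\<exists>F D. F 0 = [0] \<and> (\<forall>i. F (Suc i) = replicate (b i) (s + int i)) \<and>
     acyclic_complex V F D \<and> bounds V F D 0 = {x \<in> carrier_vec 1. x $ 0 \<in> I})"

lemma linear_resolution_zero: "linear_resolution V {0 :: ('v, 'k::field) mpoly} s (\<lambda>_. 0)"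
proof -
  let ?F = "\<lambda>i. case i of 0 \<Rightarrow> [0] | Suc j \<Rightarrow> ([] :: int list)"
  let ?D = "\<lambda>i. 0\<^sub>m (length (?F i)) 0 :: ('v, 'k) mpoly mat"
  have empty: "free_module V [] = {0\<^sub>v 0 :: ('v, 'k) mpoly vec}"
    by (auto simp: free_module_def)
  have mult0: "0\<^sub>m n 0 *\<^sub>v 0\<^sub>v 0 = (0\<^sub>v n :: ('v, 'k) mpoly vec)" for n
    by (rule eq_vecI) (simp_all add: scalar_prod_def)
  have zero: "x = 0\<^sub>v 1 \<longleftrightarrow> x \<in> carrier_vec 1 \<and> x $ 0 = 0" for x :: "('v, 'k) mpoly vec"
    by (auto intro!: eq_vecI)
  have "acyclic_complex V ?F ?D"
    unfolding acyclic_complex_def bounds_def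
  proof (intro conjI allI)
    show "graded_map V (?F (Suc i)) (?F i) (?D i)" for i by (simp add: graded_map_def)
    show "{x \<in> free_module V (?F (Suc i)). ?D i *\<^sub>v x = 0\<^sub>v (length (?F i))} =
        (*\<^sub>v) (?D (Suc i)) ` free_module V (?F (Suc (Suc i)))" for i
      using mult0 by (auto simp: empty)
  qed
  moreover have "bounds V ?F ?D 0 = {x \<in> carrier_vec 1. x $ 0 \<in> {0}}"
  proof -
    have "bounds V ?F ?D 0 = {0\<^sub>v 1}" using mult0 by (simp add: bounds_def empty)
    also have "\<dots> = {x \<in> carrier_vec 1. x $ 0 \<in> {0}}" using zero by blast
    finally show ?thesis .
  qed
  ultimately show ?thesis
    unfolding linear_resolution_def by (intro exI[of _ ?F] exI[of _ ?D]) auto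
qed

text \<open>Mapping cone over multiplication by \<open>u\<close> from \<open>R/(I : u)\<close> to \<open>R/I\<close>.\<close>

lemma linear_resolution_add_generator:
  fixes I :: "('v, 'k::field) mpoly set"
  assumes Q: "linear_resolution V I s b" and P: "linear_resolution V {g \<in> poly_ring V. u * g \<in> I} 1 c"
    and u: "u \<in> poly_ring V" "homogeneous s u"
  shows "linear_resolution V {f + u * g | f g. f \<in> I \<and> g \<in> poly_ring V} s
    (\<lambda>i. b i + (case i of 0 \<Rightarrow> 1 | Suc j \<Rightarrow> c j))"
proof -
  obtain FQ DQ where Q: "FQ 0 = [0]" "\<And>i. FQ (Suc i) = replicate (b i) (s + int i)" "acyclic_complex V FQ DQ"
    "bounds V FQ DQ 0 = {x \<in> carrier_vec 1. x $ 0 \<in> I}"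
    using Q unfolding linear_resolution_def by metis
  obtain FP' DP where P': "FP' 0 = [0]" "\<And>i. FP' (Suc i) = replicate (c i) (1 + int i)" "acyclic_complex V FP' DP"
    "bounds V FP' DP 0 = {x \<in> carrier_vec 1. x $ 0 \<in> {g \<in> poly_ring V. u * g \<in> I}}"
    using P unfolding linear_resolution_def by metis
  \<comment> \<open>The twist by the degree of \<open>u\<close> makes multiplication by
    \<open>u\<close> preserve degrees. As the resolution of the colon ideal is linear with shift 1,
    both blocks of the cone then have degree \<open>s + i\<close> in homological degree
    \<open>i + 1\<close>.\<close>
  define FP where "FP = (\<lambda>i. map ((+) s) (FP' i))"
  have P: "acyclic_complex V FP DP" "bounds V FP DP 0 = {x \<in> carrier_vec 1. x $ 0 \<in> {g \<in> poly_ring V. u * g \<in> I}}"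
    unfolding FP_def acyclic_complex_shift(2)[OF P'(3)] P'(4) by (rule acyclic_complex_shift(1)[OF P'(3)] refl)+
  have FP: "FP 0 = [s]" "FP (Suc i) = replicate (c i) (s + 1 + int i)" for i
    by (simp_all add: FP_def P'(1,2))
  define f0 where "f0 = mat 1 1 (\<lambda>_. u)"
  have f0: "(f0 *\<^sub>v x) $ 0 = u * x $ 0" if "x \<in> carrier_vec 1" for x
    using that by (simp add: f0_def scalar_prod_def)
  have f0c: "f0 *\<^sub>v x \<in> carrier_vec 1" for x :: "('v, 'k) mpoly vec" using dim_mult_mat_vec[of f0 x] unfolding f0_def by (intro carrier_vecI) (simp only: dim_row_mat)
  have fm: "x \<in> free_module V [e] \<longleftrightarrow> x \<in> carrier_vec 1 \<and> x $ 0 \<in> poly_ring V" for x :: "('v, 'k) mpoly vec" and e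
    by (simp add: free_module_def)
  have gf0: "graded_map V (FP 0) (FQ 0) f0" using u by (auto simp: FP Q(1) graded_map_def f0_def)
  have "f0 *\<^sub>v x \<in> bounds V FQ DQ 0" if "x \<in> bounds V FP DP 0" for x
    using that f0 f0c by (auto simp: P(2) Q(4))
  from chain_map_exists[OF P(1) Q(3) gf0 this]
  obtain f where f: "f 0 = f0" "\<And>i. graded_map V (FP i) (FQ i) (f i)" "\<And>i. DQ i * f (Suc i) = f i * DP i"
    by blast
  \<comment> \<open>Injectivity on the quotient by the colon ideal is the definition of the
    colon.\<close>
  have inj: "x \<in> bounds V FP DP 0" if "x \<in> free_module V (FP 0)" "f 0 *\<^sub>v x \<in> bounds V FQ DQ 0" for x
    using that f0 by (auto simp: P(2) Q(4) f(1) FP fm)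
  let ?G = "\<lambda>i. FQ i @ (case i of 0 \<Rightarrow> [] | Suc j \<Rightarrow> FP j)"
  obtain DG where G: "acyclic_complex V ?G DG"
    "bounds V ?G DG 0 = {z + f 0 *\<^sub>v x | z x. z \<in> bounds V FQ DQ 0 \<and> x \<in> free_module V (FP 0)}"
    by (rule mapping_cone[OF P(1) Q(3) f(2,3) inj])
  have "bounds V ?G DG 0 = {x \<in> carrier_vec 1. x $ 0 \<in> {f + u * g | f g. f \<in> I \<and> g \<in> poly_ring V}}" (is "_ = ?R")
  proof (intro equalityI subsetI)
    fix y assume "y \<in> bounds V ?G DG 0"
    then obtain z x where zx: "y = z + f0 *\<^sub>v x" "z \<in> carrier_vec 1" "z $ 0 \<in> I" "x \<in> carrier_vec 1" "x $ 0 \<in> poly_ring V"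
      unfolding G(2) f(1) by (auto simp: Q(4) FP fm)
    then have "y $ 0 = z $ 0 + u * x $ 0" using f0[OF zx(4)] by (simp add: f0_def)
    with zx f0c[of x] show "y \<in> ?R" by auto
  next
    fix y assume "y \<in> ?R"
    then obtain p g where y: "y \<in> carrier_vec 1" "y $ 0 = p + u * g" "p \<in> I" "g \<in> poly_ring V" by auto
    let ?z = "vec 1 (\<lambda>_. p)" and ?x = "vec 1 (\<lambda>_. g)"
    have "y = ?z + f0 *\<^sub>v ?x"
      using y by (intro eq_vecI) (auto simp: f0_def scalar_prod_def)
    moreover have "?z \<in> bounds V FQ DQ 0" "?x \<in> free_module V (FP 0)"
      using y by (simp_all add: Q(4) FP fm)
    ultimately show "y \<in> bounds V ?G DG 0" unfolding G(2) f(1) by blast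
  qed
  moreover have "?G 0 = [0]" by (simp add: Q)
  moreover have "?G (Suc i) = replicate (b i + (case i of 0 \<Rightarrow> 1 | Suc j \<Rightarrow> c j)) (s + int i)" for i
    by (cases i) (simp_all add: Q FP replicate_append_same add_ac flip: replicate_add)
  ultimately show ?thesis using G(1) unfolding linear_resolution_def by (intro exI[of _ ?G] exI[of _ DG]) auto
qed

text \<open>The entries of the first differential are homogeneous of degree \<open>s\<close>, those
  of all later ones of degree 1, and positive degree puts them into the irrelevant ideal.\<close>

lemma linear_resolution_minimal:
  fixes I :: "('v, 'k::field) mpoly set"
  assumes F: "F 0 = [0]" "\<And>i. F (Suc i) = replicate (b i) (s + int i)" and acyc: "acyclic_complex V F D"
    and b0: "bounds V F D 0 = {x \<in> carrier_vec 1. x $ 0 \<in> I}"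
    and s: "s \<ge> 1" and I: "I \<subseteq> poly_ring V" "0 \<in> I"
  shows "minimal_graded_free_resolution V I F (vec 1 (\<lambda>_. 1)) D"
proof -
  have eps: "vec 1 (\<lambda>_. 1) \<bullet> x = x $ 0" if "x \<in> free_module V (F 0)" for x :: "('v, 'k) mpoly vec"
    using that by (auto simp: F free_module_def scalar_prod_def)
  have ker: "{x \<in> free_module V (F 0). vec 1 (\<lambda>_. 1) \<bullet> x \<in> I} = bounds V F D 0"
    using eps I(1) by (auto simp: b0 F free_module_def)
  have surj: "\<exists>x\<in>free_module V (F 0). f - vec 1 (\<lambda>_. 1) \<bullet> x \<in> I" if "f \<in> poly_ring V" for f
    using that eps[of "vec 1 (\<lambda>_. f)"] I(2) by (intro bexI[of _ "vec 1 (\<lambda>_. f)"]) (auto simp: F free_module_def)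
  have "graded_free_resolution V I F (vec 1 (\<lambda>_. 1)) D"
    using acyc ker surj unfolding graded_free_resolution_def acyclic_complex_def bounds_def
    by (auto simp: F free_module_def)
  moreover have "D i $$ (k, l) \<in> irrelevant_ideal V" if kl: "k < length (F i)" "l < length (F (Suc i))" for i k l
  proof (rule homogeneous_irrelevant_ideal)
    have "graded_map V (F (Suc i)) (F i) (D i)" using acyc by (simp add: acyclic_complex_def)
    then show "D i $$ (k, l) \<in> poly_ring V" "homogeneous (F (Suc i) ! l - F i ! k) (D i $$ (k, l))"
      using kl by (auto simp: graded_map_def)
    show "F (Suc i) ! l - F i ! k > 0" using kl s by (cases i) (simp_all add: F)
  qed
  ultimately show ?thesis by (simp add: minimal_graded_free_resolution_def)
qed

text \<open>The linear resolution witnesses the description in \<open>graded_betti\<close>, and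
  \<open>count_list_minimal_resolution\<close> makes the value unique. All \<open>b i\<close> basis
  vectors share one degree, so the count is all or nothing.\<close>

lemma graded_betti_linear_resolution:
  fixes M :: "('v \<Rightarrow>\<^sub>0 nat) set"
  assumes "linear_resolution V (monomial_ideal V M :: ('v, 'k::field) mpoly set) s b" "s \<ge> 1"
  shows "graded_betti V (monomial_ideal V M :: ('v, 'k) mpoly set) (Suc i) j = (if j = s + int i then b i else 0)"
proof -
  let ?I = "monomial_ideal V M :: ('v, 'k) mpoly set"
  obtain F D where F: "F 0 = [0]" "\<And>i. F (Suc i) = replicate (b i) (s + int i)" "acyclic_complex V F D"
    "bounds V F D 0 = {x \<in> carrier_vec 1. x $ 0 \<in> ?I}"
    using assms(1) by (auto simp: linear_resolution_def)
  have min: "minimal_graded_free_resolution V ?I F (vec 1 (\<lambda>_. 1)) D"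
    by (rule linear_resolution_minimal[OF F assms(2) monomial_ideal_subset]) (simp add: monomial_ideal_def)
  have "graded_betti V ?I (Suc i) j = count_list (F (Suc i)) j"
    unfolding graded_betti_def
  proof (rule the_equality)
    show "\<exists>F' \<epsilon> D'. minimal_graded_free_resolution V ?I F' \<epsilon> D' \<and> count_list (F (Suc i)) j = count_list (F' (Suc i)) j"
      using min by blast
    fix b' assume "\<exists>F' \<epsilon> D'. minimal_graded_free_resolution V ?I F' \<epsilon> D' \<and> b' = count_list (F' (Suc i)) j"
    then show "b' = count_list (F (Suc i)) j"
      using count_list_minimal_resolution[OF min F(1)] by blast
  qed
  also have "\<dots> = (if j = s + int i then b i else 0)"
    by (simp add: F(2) count_list_eq_length_filter)
  finally show ?thesis .
qed

section \<open>Linear quotients\<close>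

text \<open>Multiplication by a monomial only translates exponents, so membership in the colon is
  decided term by term, and colon ideals become a matter of exponent vectors.\<close>

lemma monomial_ideal_colon:
  fixes V :: "'v set"
  assumes m: "Poly_Mapping.keys m \<subseteq> V"
    and eq: "\<And>k. (\<exists>m'\<in>M. \<forall>x. Poly_Mapping.lookup m' x \<le> Poly_Mapping.lookup m x + Poly_Mapping.lookup k x)
      \<longleftrightarrow> (\<exists>m'\<in>N. \<forall>x. Poly_Mapping.lookup m' x \<le> Poly_Mapping.lookup k x)"
  shows "{g \<in> poly_ring V. Poly_Mapping.single m 1 * g \<in> monomial_ideal V M}
    = (monomial_ideal V N :: ('v, 'k::field) mpoly set)"
proof -
  have "Poly_Mapping.single m 1 * g \<in> monomial_ideal V M \<longleftrightarrow> g \<in> monomial_ideal V N"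
    if g: "g \<in> poly_ring V" for g :: "('v, 'k) mpoly"
  proof -
    have "Poly_Mapping.single m 1 * g \<in> poly_ring V"
      using m g by (intro poly_ring_mult) (auto simp: poly_ring_def)
    then show ?thesis
      using g eq by (simp add: monomial_ideal_def keys_single_mult lookup_add)
  qed
  then show ?thesis using monomial_ideal_subset by blast
qed

lemma monomial_ideal_empty: "monomial_ideal V {} = {0}"
proof -
  have "f = 0" if "Poly_Mapping.keys f = {}" for f :: "('a, 'b) mpoly"
    using that by simp
  then show ?thesis by (auto simp: monomial_ideal_def)
qed

text \<open>One step of the linear quotients: \<open>eq\<close> expresses that \<open>N\<close>
  generates the colon ideal of \<open>M\<close> at \<open>m\<close>.\<close>

lemma linear_resolution_insert_monomial:
  fixes V :: "'v set"
  assumes m: "Poly_Mapping.keys m \<subseteq> V" and s: "int (monomial_degree m) = s"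
    and Q: "linear_resolution V (monomial_ideal V M :: ('v, 'k::field) mpoly set) s b"
    and P: "linear_resolution V (monomial_ideal V N :: ('v, 'k) mpoly set) 1 c"
    and eq: "\<And>k. (\<exists>m'\<in>M. \<forall>x. Poly_Mapping.lookup m' x \<le> Poly_Mapping.lookup m x + Poly_Mapping.lookup k x)
      \<longleftrightarrow> (\<exists>m'\<in>N. \<forall>x. Poly_Mapping.lookup m' x \<le> Poly_Mapping.lookup k x)"
  shows "linear_resolution V (monomial_ideal V (insert m M) :: ('v, 'k) mpoly set) s
    (\<lambda>i. b i + (case i of 0 \<Rightarrow> 1 | Suc j \<Rightarrow> c j))"
  unfolding monomial_ideal_insert[OF m]
proof (rule linear_resolution_add_generator[OF Q])
  show "linear_resolution V {g \<in> poly_ring V. Poly_Mapping.single m 1 * g \<in> (monomial_ideal V M :: ('v, 'k) mpoly set)} 1 c"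
    unfolding monomial_ideal_colon[OF m eq] by (rule P)
  show "Poly_Mapping.single m 1 \<in> (poly_ring V :: ('v, 'k) mpoly set)" using m by (simp add: poly_ring_def)
  show "homogeneous s (Poly_Mapping.single m 1 :: ('v, 'k) mpoly)" using s by (simp add: homogeneous_def)
qed

lemma single_le_iff:
  "(\<forall>x. Poly_Mapping.lookup (Poly_Mapping.single t (1::nat)) x \<le> h x) \<longleftrightarrow> h t \<ge> 1"
  by (auto simp: lookup_single when_def)

text \<open>The minimal resolution is the Koszul complex.\<close>

lemma linear_resolution_variables:
  fixes V :: "'v set"
  assumes "finite T" "T \<subseteq> V"
  shows "linear_resolution V (monomial_ideal V ((\<lambda>t. Poly_Mapping.single t 1) ` T) :: ('v, 'k::field) mpoly set) 1
    (\<lambda>i. card T choose Suc i)"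
  using assms
proof (induction T)
  case empty
  then show ?case using linear_resolution_zero by (simp add: monomial_ideal_empty)
next
  case (insert t T)
  let ?X = "\<lambda>t::'v. Poly_Mapping.single t (1::nat)"
  have IH: "linear_resolution V (monomial_ideal V (?X ` T) :: ('v, 'k) mpoly set) 1 (\<lambda>i. card T choose Suc i)"
    using insert by auto
  have "linear_resolution V (monomial_ideal V (insert (?X t) (?X ` T)) :: ('v, 'k) mpoly set) 1
    (\<lambda>i. (card T choose Suc i) + (case i of 0 \<Rightarrow> 1 | Suc j \<Rightarrow> card T choose Suc j))"
  \<comment> \<open>A monomial times a variable outside \<open>T\<close> is divisible by a variable
    from \<open>T\<close> only if the monomial is. The colon is therefore the ideal itself, and the
    induction hypothesis serves at both ends of the cone.\<close>
  proof (rule linear_resolution_insert_monomial[OF _ _ IH IH])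
    show "Poly_Mapping.keys (?X t) \<subseteq> V" using insert by simp
    show "int (monomial_degree (?X t)) = 1" by (simp add: monomial_degree_def)
    fix k
    show "(\<exists>m'\<in>?X ` T. \<forall>x. Poly_Mapping.lookup m' x \<le> Poly_Mapping.lookup (?X t) x + Poly_Mapping.lookup k x)
      \<longleftrightarrow> (\<exists>m'\<in>?X ` T. \<forall>x. Poly_Mapping.lookup m' x \<le> Poly_Mapping.lookup k x)"
      using insert(2) unfolding bex_simps(7) single_le_iff by (auto simp: lookup_single when_def)
  qed
  \<comment> \<open>Pascal's rule; for \<open>i = 0\<close> the summand 1 is
    \<open>card T choose 0\<close>.\<close>
  moreover have "(card T choose Suc i) + (case i of 0 \<Rightarrow> 1 | Suc j \<Rightarrow> card T choose Suc j)
      = card (insert t T) choose Suc i" for i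
    using insert by (cases i) simp_all
  ultimately show ?case by simp
qed

section \<open>Squarefree monomials, ordered by the sum of their vertices\<close>

definition squarefree_monomial :: "'v set \<Rightarrow> 'v \<Rightarrow>\<^sub>0 nat" where
  "squarefree_monomial A = (\<Sum>x\<in>A. Poly_Mapping.single x 1)"

lemma lookup_squarefree_monomial:
  "finite A \<Longrightarrow> Poly_Mapping.lookup (squarefree_monomial A) x = (if x \<in> A then 1 else 0)"
  by (simp add: squarefree_monomial_def lookup_sum lookup_single when_def)

lemma keys_squarefree_monomial: "finite A \<Longrightarrow> Poly_Mapping.keys (squarefree_monomial A) = A"
  by (auto simp: in_keys_iff lookup_squarefree_monomial split: if_splits)

lemma monomial_degree_squarefree: "finite A \<Longrightarrow> monomial_degree (squarefree_monomial A) = card A"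
  by (simp add: monomial_degree_def keys_squarefree_monomial lookup_squarefree_monomial)

lemma prod_var: "finite A \<Longrightarrow> (\<Prod>x\<in>A. var x) = (Poly_Mapping.single (squarefree_monomial A) 1 :: ('v, 'k::field) mpoly)"
  by (induction A rule: finite_induct) (simp_all add: squarefree_monomial_def var_def mult_single)

text \<open>If \<open>w - u\<close> contained only elements above \<open>u\<close>, then \<open>w\<close> would have a larger sum than \<open>u\<close>.\<close>

lemma exists_below_if_sum_le:
  fixes p :: "'v \<Rightarrow> nat"
  assumes fin: "finite u" "finite w" and card: "card w = card u" and ne: "w \<noteq> u"
    and inj: "inj_on p (u \<union> w)" and le: "sum p w \<le> sum p u"
  shows "\<exists>t\<in>w - u. \<exists>y\<in>u. p t < p y"
proof (rule ccontr)
  assume neg: "\<not> ?thesis"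
  have cd: "card (w - u) = card (u - w)"
    using card card_Diff_subset_Int[of w u] card_Diff_subset_Int[of u w] fin by (simp add: Int_commute)
  have "w - u \<noteq> {}"
  proof
    assume "w - u = {}"
    then have "w \<subseteq> u" by auto
    then show False using card_subset_eq[OF fin(1)] card ne by blast
  qed
  then have c0: "card (u - w) > 0" using fin cd by (metis card_gt_0_iff finite_Diff)
  then have ne': "u - w \<noteq> {}" by (metis card.empty less_irrefl)
  \<comment> \<open>\<open>M\<close> separates the two differences: \<open>p\<close> is at most
    \<open>M\<close> on \<open>u - w\<close> and at least \<open>M + 1\<close> on
    \<open>w - u\<close>, strictly because \<open>p\<close> is injective. The differences have equal
    size, so their sums compare strictly.\<close>
  define M where "M = Max (p ` (u - w))"
  have M: "p y \<le> M" if "y \<in> u - w" for y using that fin unfolding M_def by (intro Max_ge) auto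
  have "M \<in> p ` (u - w)" unfolding M_def using fin ne' by (intro Max_in) auto
  then obtain y where y: "y \<in> u - w" "M = p y" by auto
  have M': "Suc M \<le> p t" if t: "t \<in> w - u" for t
  proof -
    have "p y \<le> p t" using neg t y by (auto simp: not_less)
    moreover have "p y \<noteq> p t" using inj_onD[OF inj, of y t] t y by auto
    ultimately show ?thesis using y by simp
  qed
  have "sum p (u - w) \<le> card (u - w) * M" using sum_bounded_above[of "u - w" p M] M by simp
  also have "\<dots> < card (u - w) * Suc M" using c0 by simp
  also have "\<dots> \<le> sum p (w - u)" using sum_bounded_below[of "w - u" "Suc M" p] M' cd by simp
  finally have "sum p (u - w) < sum p (w - u)" .
  moreover have "sum p u = sum p (u \<inter> w) + sum p (u - w)" "sum p w = sum p (u \<inter> w) + sum p (w - u)"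
    using sum.Int_Diff[OF fin(1), of p w] sum.Int_Diff[OF fin(2), of p u] by (simp_all add: Int_commute)
  ultimately show False using le by simp
qed

text \<open>Families closed under passing to a smaller sum stay so when a member \<open>u\<close> of
  largest sum is removed, which makes the induction possible. The summand of \<open>u\<close> is the
  rank of the Koszul complex on the vertices outside \<open>u\<close> below its maximum; its value 1
  at \<open>i = 0\<close> accounts for the generator itself.\<close>

lemma linear_resolution_squarefree:
  fixes V :: "'v set" and p :: "'v \<Rightarrow> nat"
  assumes V: "finite V" and inj: "inj_on p V"
    and S: "finite S" "\<And>u. u \<in> S \<Longrightarrow> u \<subseteq> V \<and> card u = d"
    "\<And>u w. u \<in> S \<Longrightarrow> w \<subseteq> V \<Longrightarrow> card w = d \<Longrightarrow> sum p w < sum p u \<Longrightarrow> w \<in> S"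
  shows "linear_resolution V (monomial_ideal V (squarefree_monomial ` S) :: ('v, 'k::field) mpoly set) (int d)
    (\<lambda>i. \<Sum>u\<in>S. card {t \<in> V - u. \<exists>y\<in>u. p t < p y} choose i)"
  using S
proof (induction "card S" arbitrary: S)
  case 0
  then show ?case using linear_resolution_zero by (simp add: monomial_ideal_empty)
next
  case (Suc n)
  note S = Suc.prems
  have "S \<noteq> {}" using Suc(2) by auto
  then have "Max (sum p ` S) \<in> sum p ` S" using S(1) by (intro Max_in) auto
  then obtain u where u: "u \<in> S" "sum p u = Max (sum p ` S)" by auto
  have max: "sum p w \<le> sum p u" if "w \<in> S" for w unfolding u(2) using S(1) that by (intro Max_ge) auto
  let ?S = "S - {u}"
  let ?T = "{t \<in> V - u. \<exists>y\<in>u. p t < p y}"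
  have uV: "u \<subseteq> V" "card u = d" "finite u" using S(2)[OF u(1)] V by (auto intro: finite_subset)
  have fin: "finite w" if "w \<in> S" for w using S(2)[OF that] V by (auto intro: finite_subset)
  have "linear_resolution V (monomial_ideal V (squarefree_monomial ` ?S) :: ('v, 'k) mpoly set) (int d)
    (\<lambda>i. \<Sum>u\<in>?S. card {t \<in> V - u. \<exists>y\<in>u. p t < p y} choose i)"
  proof (rule Suc.hyps(1))
    show "n = card ?S" using Suc(2) u(1) S(1) by simp
    show "finite ?S" using S(1) by simp
    show "w \<subseteq> V \<and> card w = d" if "w \<in> ?S" for w using S(2) that by blast
    \<comment> \<open>The closure property cannot force \<open>u\<close> back in, because the sum of
      \<open>u\<close> is maximal.\<close>
    show "w \<in> ?S" if "v \<in> ?S" "w \<subseteq> V" "card w = d" "sum p w < sum p v" for v w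
      using S(3)[of v w] that max[of v] by auto
  qed
  moreover have "linear_resolution V (monomial_ideal V ((\<lambda>t. Poly_Mapping.single t 1) ` ?T) :: ('v, 'k) mpoly set) 1
    (\<lambda>i. card ?T choose Suc i)"
    using V by (intro linear_resolution_variables) auto
  ultimately have "linear_resolution V
      (monomial_ideal V (insert (squarefree_monomial u) (squarefree_monomial ` ?S)) :: ('v, 'k) mpoly set) (int d)
      (\<lambda>i. (\<Sum>u\<in>?S. card {t \<in> V - u. \<exists>y\<in>u. p t < p y} choose i) + (case i of 0 \<Rightarrow> 1 | Suc j \<Rightarrow> card ?T choose Suc j))"
  proof (rule linear_resolution_insert_monomial[rotated 2])
    show "Poly_Mapping.keys (squarefree_monomial u) \<subseteq> V" using uV by (simp add: keys_squarefree_monomial)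
    show "int (monomial_degree (squarefree_monomial u)) = int d" using uV by (simp add: monomial_degree_squarefree)
    fix k :: "'v \<Rightarrow>\<^sub>0 nat"
    show "(\<exists>m'\<in>squarefree_monomial ` ?S. \<forall>x. Poly_Mapping.lookup m' x
          \<le> Poly_Mapping.lookup (squarefree_monomial u) x + Poly_Mapping.lookup k x)
      \<longleftrightarrow> (\<exists>m'\<in>(\<lambda>t. Poly_Mapping.single t 1) ` ?T. \<forall>x. Poly_Mapping.lookup m' x \<le> Poly_Mapping.lookup k x)"
      unfolding bex_simps(7) single_le_iff
    proof
      assume "\<exists>w\<in>?S. \<forall>x. Poly_Mapping.lookup (squarefree_monomial w) x
          \<le> Poly_Mapping.lookup (squarefree_monomial u) x + Poly_Mapping.lookup k x"
      then obtain w where w: "w \<in> S" "w \<noteq> u" "\<And>x. Poly_Mapping.lookup (squarefree_monomial w) x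
          \<le> Poly_Mapping.lookup (squarefree_monomial u) x + Poly_Mapping.lookup k x" by auto
      have "inj_on p (u \<union> w)" using inj_on_subset[OF inj] S(2)[OF w(1)] uV by auto
      then obtain t where t: "t \<in> w - u" "\<exists>y\<in>u. p t < p y"
        using exists_below_if_sum_le[OF uV(3) fin[OF w(1)] _ w(2) _ max[OF w(1)]] S(2)[OF w(1)] uV(2) by auto
      \<comment> \<open>The variable \<open>t\<close> divides the monomial of \<open>w\<close> but
        not that of \<open>u\<close>, so it divides \<open>k\<close>.\<close>
      moreover have "1 \<le> Poly_Mapping.lookup k t"
        using w(3)[of t] t(1) fin[OF w(1)] uV by (simp add: lookup_squarefree_monomial)
      ultimately show "\<exists>t\<in>?T. 1 \<le> Poly_Mapping.lookup k t" using S(2)[OF w(1)] by blast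
    next
      assume "\<exists>t\<in>?T. 1 \<le> Poly_Mapping.lookup k t"
      then obtain t y where t: "t \<in> V" "t \<notin> u" "y \<in> u" "p t < p y" "1 \<le> Poly_Mapping.lookup k t" by auto
      \<comment> \<open>Trading \<open>y\<close> for the smaller \<open>t\<close> lowers the sum, so
        \<open>?w\<close> belongs to \<open>S\<close>, and its monomial divides that of
        \<open>u\<close> times \<open>t\<close>.\<close>
      let ?w = "insert t (u - {y})"
      have "sum p ?w = p t + sum p (u - {y})" using t uV by simp
      moreover have "sum p u = p y + sum p (u - {y})" using t uV by (intro sum.remove) auto
      ultimately have lt: "sum p ?w < sum p u" using t by simp
      moreover have "card ?w = d" using t uV card_gt_0_iff[of u] by auto
      ultimately have "?w \<in> S" using t uV by (intro S(3)[OF u(1)]) auto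
      moreover have "?w \<noteq> u" using t by auto
      moreover have "Poly_Mapping.lookup (squarefree_monomial ?w) x
          \<le> Poly_Mapping.lookup (squarefree_monomial u) x + Poly_Mapping.lookup k x" for x
        using t uV by (simp add: lookup_squarefree_monomial)
      ultimately show "\<exists>w\<in>?S. \<forall>x. Poly_Mapping.lookup (squarefree_monomial w) x
          \<le> Poly_Mapping.lookup (squarefree_monomial u) x + Poly_Mapping.lookup k x" by blast
    qed
  qed
  moreover have "insert (squarefree_monomial u) (squarefree_monomial ` ?S) = squarefree_monomial ` S"
    using u by auto
  moreover have "(\<Sum>u\<in>?S. card {t \<in> V - u. \<exists>y\<in>u. p t < p y} choose i) + (case i of 0 \<Rightarrow> 1 | Suc j \<Rightarrow> card ?T choose Suc j)
      = (\<Sum>u\<in>S. card {t \<in> V - u. \<exists>y\<in>u. p t < p y} choose i)" for i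
    using sum.remove[OF S(1) u(1), of "\<lambda>u. card {t \<in> V - u. \<exists>y\<in>u. p t < p y} choose i"]
    by (cases i) simp_all
  ultimately show ?case by simp
qed

text \<open>A pair of \<open>u\<close> and a set \<open>\<sigma>\<close> of \<open>i\<close> elements outside \<open>u\<close> below its maximum amounts to a set
  \<open>A = u \<union> \<sigma>\<close> and an \<open>i\<close>-subset \<open>\<sigma>\<close> of \<open>A\<close> that avoids the maximum of \<open>A\<close>.\<close>

lemma sum_choose_below_max:
  fixes V :: "'v set" and p :: "'v \<Rightarrow> nat"
  assumes V: "finite V" and inj: "inj_on p V"
  shows "(\<Sum>u | u \<subseteq> V \<and> card u = Suc r. card {t \<in> V - u. \<exists>y\<in>u. p t < p y} choose i)
    = (i + r choose r) * (card V choose (i + Suc r))"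
proof -
  let ?B = "\<lambda>A. {t \<in> A. \<exists>y\<in>A. p t < p y}"
  let ?T = "\<lambda>u. {t \<in> V - u. \<exists>y\<in>u. p t < p y}"
  let ?L = "SIGMA u:{u. u \<subseteq> V \<and> card u = Suc r}. {\<sigma>. \<sigma> \<subseteq> ?T u \<and> card \<sigma> = i}"
  let ?R = "SIGMA A:{A. A \<subseteq> V \<and> card A = i + Suc r}. {\<sigma>. \<sigma> \<subseteq> ?B A \<and> card \<sigma> = i}"
  have fin: "finite A" if "A \<subseteq> V" for A using finite_subset[OF that V] .
  have max: "\<exists>y\<in>A. \<forall>t\<in>A. p t \<le> p y" if "A \<subseteq> V" "A \<noteq> {}" for A
  proof -
    have "Max (p ` A) \<in> p ` A" using fin that by (intro Max_in) auto
    then obtain y where "y \<in> A" "p y = Max (p ` A)" by auto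
    then show ?thesis using fin[OF that(1)] by (intro bexI[of _ y]) auto
  qed
  have cardB: "card (?B A) = card A - 1" if A: "A \<subseteq> V" "A \<noteq> {}" for A
  proof -
    obtain y where y: "y \<in> A" "\<forall>t\<in>A. p t \<le> p y" using max[OF A] by blast
    have "?B A = A - {y}"
    proof (intro equalityI subsetI)
      fix t assume t: "t \<in> A - {y}"
      then have "p t \<noteq> p y" using inj_onD[OF inj, of t y] y A by auto
      with t y show "t \<in> ?B A" by (auto simp: le_less)
    qed (use y in \<open>auto simp: not_le[symmetric]\<close>)
    then show ?thesis using y fin[OF A(1)] by simp
  qed
  have "bij_betw (\<lambda>(u, \<sigma>). (u \<union> \<sigma>, \<sigma>)) ?L ?R"
  proof (rule bij_betw_byWitness[where f' = "\<lambda>(A, \<sigma>). (A - \<sigma>, \<sigma>)"])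
    show "\<forall>a\<in>?L. (\<lambda>(A, \<sigma>). (A - \<sigma>, \<sigma>)) ((\<lambda>(u, \<sigma>). (u \<union> \<sigma>, \<sigma>)) a) = a" by auto
    show "\<forall>a\<in>?R. (\<lambda>(u, \<sigma>). (u \<union> \<sigma>, \<sigma>)) ((\<lambda>(A, \<sigma>). (A - \<sigma>, \<sigma>)) a) = a" by auto
    show "(\<lambda>(u, \<sigma>). (u \<union> \<sigma>, \<sigma>)) ` ?L \<subseteq> ?R"
    proof
      fix x assume "x \<in> (\<lambda>(u, \<sigma>). (u \<union> \<sigma>, \<sigma>)) ` ?L"
      then obtain u \<sigma> where x: "x = (u \<union> \<sigma>, \<sigma>)" and u: "u \<subseteq> V" "card u = Suc r"
        and \<sigma>: "\<sigma> \<subseteq> ?T u" "card \<sigma> = i" by auto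
      have "u \<inter> \<sigma> = {}" "finite u" "finite \<sigma>" using u \<sigma> by (auto intro: fin)
      then have "card (u \<union> \<sigma>) = i + Suc r"
        using u(2) \<sigma>(2) by (simp add: card_Un_disjoint)
      with u \<sigma> show "x \<in> ?R" unfolding x by auto
    qed
    show "(\<lambda>(A, \<sigma>). (A - \<sigma>, \<sigma>)) ` ?R \<subseteq> ?L"
    proof
      fix x assume "x \<in> (\<lambda>(A, \<sigma>). (A - \<sigma>, \<sigma>)) ` ?R"
      then obtain A \<sigma> where x: "x = (A - \<sigma>, \<sigma>)" and A: "A \<subseteq> V" "card A = i + Suc r"
        and \<sigma>: "\<sigma> \<subseteq> ?B A" "card \<sigma> = i" by auto
      have "A \<noteq> {}" using A by auto
      then obtain y where y: "y \<in> A" "\<forall>t\<in>A. p t \<le> p y" using max[OF A(1)] by blast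
      \<comment> \<open>Every element of \<open>\<sigma>\<close> lies strictly below some element of
        \<open>A\<close>, so the maximum \<open>y\<close> of \<open>A\<close> survives in
        \<open>A - \<sigma>\<close> and dominates all of \<open>\<sigma>\<close>.\<close>
      have yu: "y \<in> A - \<sigma>" using y \<sigma> by (auto simp: not_le[symmetric])
      have "card (A - \<sigma>) = Suc r" using A \<sigma> fin[OF A(1)] by (subst card_Diff_subset) (auto intro: finite_subset)
      moreover have "\<sigma> \<subseteq> ?T (A - \<sigma>)"
      proof
        fix t assume t: "t \<in> \<sigma>"
        then obtain z where "t \<in> A" "z \<in> A" "p t < p z" using \<sigma> by auto
        then have "p t < p y" using y by (meson less_le_trans)
        then show "t \<in> ?T (A - \<sigma>)" using t yu A \<open>t \<in> A\<close> by auto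
      qed
      ultimately show "x \<in> ?L" unfolding x using A \<sigma> by auto
    qed
  qed
  then have eq: "card ?L = card ?R" by (rule bij_betw_same_card)
  have finP: "finite {u. u \<subseteq> V \<and> P u}" for P using V by simp
  have L: "card ?L = (\<Sum>u | u \<subseteq> V \<and> card u = Suc r. card (?T u) choose i)"
    using V finP by (subst card_SigmaI) (auto simp: n_subsets)
  have "card ?R = (\<Sum>A | A \<subseteq> V \<and> card A = i + Suc r. card {\<sigma>. \<sigma> \<subseteq> ?B A \<and> card \<sigma> = i})"
    using fin finP by (subst card_SigmaI) auto
  also have "\<dots> = (\<Sum>A | A \<subseteq> V \<and> card A = i + Suc r. i + r choose r)"
  proof (rule sum.cong[OF refl])
    fix A assume A: "A \<in> {A. A \<subseteq> V \<and> card A = i + Suc r}"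
    then have "card (?B A) = i + r" using cardB[of A] by force
    moreover have "finite (?B A)" using fin[of A] A by auto
    ultimately show "card {\<sigma>. \<sigma> \<subseteq> ?B A \<and> card \<sigma> = i} = (i + r choose r)"
      using binomial_symmetric[of i "i + r"] by (simp add: n_subsets)
  qed
  also have "\<dots> = (i + r choose r) * (card V choose (i + Suc r))"
    using V by (simp add: n_subsets mult.commute)
  finally show ?thesis using eq L by simp
qed

text \<open>An arc joins any two distinct vertices and survives in the induced subgraph.
  Connectedness means strong connectedness of the symmetric closure, hence the paths in
  \<open>mk_symmetric\<close>; it also demands a vertex, hence the nonempty
  \<open>A\<close>.\<close>

lemma complete_digraph_induced_connected:
  assumes G: "K\<^bsub>n\<^esub> G" and A: "A \<subseteq> verts G" "A \<noteq> {}"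
  shows "Digraph_Component.connected (G \<restriction> A)"
proof -
  have arcs: "\<exists>e\<in>arcs G. tail G e = u \<and> head G e = v" if "u \<in> A" "v \<in> A" "u \<noteq> v" for u v
  proof -
    have "(u, v) \<in> arcs_ends G" using G A that by (auto simp: complete_digraph_def)
    then show ?thesis by (auto simp: arcs_ends_def arc_to_ends_def)
  qed
  have "u \<rightarrow>\<^sup>*\<^bsub>with_proj (mk_symmetric (G \<restriction> A))\<^esub> v" if uv: "u \<in> A" "v \<in> A" for u v
  proof (cases "u = v")
    case True
    then show ?thesis using uv by (auto simp: reachable_def mk_symmetric_def intro: rtrancl_on.intros)
  next
    case False
    then obtain e where e: "e \<in> arcs G" "tail G e = u" "head G e = v" using arcs uv by blast
    then have "(u, v) \<in> parcs (mk_symmetric (G \<restriction> A))"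
      using uv by (force simp: mk_symmetric_def)
    then have "(u, v) \<in> arcs_ends (with_proj (mk_symmetric (G \<restriction> A)))"
      by (simp add: arcs_ends_def arc_to_ends_def)
    then show ?thesis
      using uv unfolding reachable_def by (intro rtrancl_on_into_rtrancl_on[OF rtrancl_on_refl]) (auto simp: mk_symmetric_def)
  qed
  then show ?thesis
    using A(2) by (auto simp: Digraph_Component.connected_def strongly_connected_def mk_symmetric_def)
qed

text \<open>Since \<open>r + 1 > 0\<close>, every candidate set is nonempty and thus induces a
  connected subgraph, so all of them give generators.\<close>

lemma connected_ideal_complete_digraph:
  fixes G :: "('v, 'e) pre_digraph"
  assumes G: "K\<^bsub>n\<^esub> G"
  shows "connected_ideal r G = (monomial_ideal (verts G)
    (squarefree_monomial ` {A. A \<subseteq> verts G \<and> card A = Suc r}) :: ('v, 'k::field) mpoly set)"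
    (is "_ = monomial_ideal _ (_ ` ?S)")
proof -
  have fin: "finite A" if "card A = Suc r" for A :: "'v set" using that by (simp add: card_ge_0_finite)
  have "A \<noteq> {}" if "card A = Suc r" for A :: "'v set" using that by auto
  then have "{(\<Prod>x\<in>A. var x) | A. A \<subseteq> verts G \<and> card A = r + 1 \<and> Digraph_Component.connected (G \<restriction> A)}
    = (\<lambda>A. \<Prod>x\<in>A. var x :: ('v, 'k) mpoly) ` ?S"
    using complete_digraph_induced_connected[OF G] by (auto simp: image_def)
  also have "\<dots> = (\<lambda>A. Poly_Mapping.single (squarefree_monomial A) 1) ` ?S"
    by (rule image_cong[OF refl]) (simp add: prod_var fin)
  also have "\<dots> = (\<lambda>m. Poly_Mapping.single m 1) ` squarefree_monomial ` ?S"
    by (simp only: image_image)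
  finally have gens: "{(\<Prod>x\<in>A. var x) | A. A \<subseteq> verts G \<and> card A = r + 1 \<and> Digraph_Component.connected (G \<restriction> A)}
    = (\<lambda>m. Poly_Mapping.single m (1::'k)) ` squarefree_monomial ` ?S" .
  show ?thesis
    unfolding connected_ideal_def gens
    by (rule generated_ideal_monomial) (auto simp: keys_squarefree_monomial fin)
qed

theorem theorem4p1:
  fixes G :: "('v, 'e) pre_digraph" and n r i :: nat and d :: int
  assumes "n \<ge> 1" and "K\<^bsub>n\<^esub> G" and "r \<ge> 1" and "i \<ge> 1"
  shows "graded_betti (verts G) (connected_ideal r G :: ('v, 'k::field) mpoly set) i (int i + d) =
    (if d = int r \<and> 1 \<le> i \<and> int i \<le> int n - int r
     then (nat (int i + d - 1) choose nat d) * (n choose nat (int i + d))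
     else 0)"
proof -
  let ?V = "verts G"
  have V: "finite ?V" "card ?V = n"
    using assms(1,2) by (auto simp: complete_digraph_def card_ge_0_finite)
  \<comment> \<open>Any injection into the natural numbers serves as the numbering of the
    vertices.\<close>
  obtain p :: "'v \<Rightarrow> nat" where p: "inj_on p ?V"
    using finite_imp_inj_to_nat_seg[OF V(1)] by blast
  obtain j where i: "i = Suc j" using assms(4) by (cases i) auto
  let ?S = "{A. A \<subseteq> ?V \<and> card A = Suc r}"
  have "linear_resolution ?V (monomial_ideal ?V (squarefree_monomial ` ?S) :: ('v, 'k) mpoly set) (int (Suc r))
    (\<lambda>i. \<Sum>u\<in>?S. card {t \<in> ?V - u. \<exists>y\<in>u. p t < p y} choose i)"
    using V by (intro linear_resolution_squarefree[OF V(1) p]) auto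
  then have "graded_betti ?V (connected_ideal r G :: ('v, 'k) mpoly set) i (int i + d)
      = (if int i + d = int (Suc r) + int j then \<Sum>u\<in>?S. card {t \<in> ?V - u. \<exists>y\<in>u. p t < p y} choose j else 0)"
    unfolding connected_ideal_complete_digraph[OF assms(2)] i
    by (rule graded_betti_linear_resolution) simp
  also have "\<dots> = (if d = int r then (j + r choose r) * (n choose (j + Suc r)) else 0)"
    unfolding sum_choose_below_max[OF V(1) p] V(2) i by simp
  \<comment> \<open>Here \<open>j + Suc r = i + r\<close>, so \<open>n choose (j + Suc r)\<close> is
    zero as soon as \<open>i + r > n\<close>, in agreement with the range of \<open>i\<close> in the
    theorem.\<close>
  also have "\<dots> = (if d = int r \<and> 1 \<le> i \<and> int i \<le> int n - int r
     then (nat (int i + d - 1) choose nat d) * (n choose nat (int i + d)) else 0)"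
  proof (cases "d = int r")
    case True
    have "nat (int i + d - 1) = j + r" "nat (int i + d) = j + Suc r" using True i by auto
    then show ?thesis using True i by auto
  qed simp
  finally show ?thesis .
qed

end
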